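(* Fix a boundary condition $\hat{\mathbf{A}}\in\mathcal{B}^{\mathbb{C}}$. Assume that either $\mu_1=0,\ \mu_2\ne0$, or $\mu_1\ne0,\ \mu_2=0$. Then for each $\boldsymbol\omega\in\Omega_N^{\mathbb{R},+}$, $(\boldsymbol\omega,\hat{\mathbf{A}})$ has exactly $N$ eigenvalues $\lambda_n(\boldsymbol\omega):=\lambda_n(\boldsymbol\omega,\hat{\mathbf{A}})$, $0\le n\le N-1$, which satisfy: (i) each $\lambda_n$ is continuous in $\Omega_N^{\mathbb{R},+}$; (ii) each $\lambda_n$ restricted to each connected component of $\Omega_N^{\mathbb{R},+}$ is non-increasing in every $(1/f_j)$-direction ($0\le j\le N-1$), independent of $f_N$, and non-decreasing in every $q_j$-direction ($1\le j\le N$), while its positive part $\max\{\lambda_n,0\}$ and negative part $\min\{\lambda_n,0\}$ are respectively non-increasing and non-decreasing in every $w_j$-direction ($1\le j\le N$).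
   Context: Fix an integer $N\ge 2$. A self-adjoint discrete Sturm–Liouville problem is a pair $(\boldsymbol\omega,\mathbf{A})$. Here $\boldsymbol\omega=(1/f,q,w)$ with real sequences $f=\{f_n\}_{n=0}^N$, $q=\{q_n\}_{n=1}^N$, $w=\{w_n\}_{n=1}^N$, $f_n\ne0$, $w_n>0$, encodes the equation $-\nabla(f_n\Delta y_n)+q_ny_n=\lambda w_ny_n$, $1\le n\le N$, for $y=(y_0,\dots,y_{N+1})$, with $\Delta y_n=y_{n+1}-y_n$, $\nabla y_n=y_n-y_{n-1}$; the set $\Omega_N^{\mathbb{R},+}$ of all such $(1/f,q,w)$ has the topology of a subset of $\mathbb{R}^{3N+1}$, with coordinates $1/f_0,\dots,1/f_N,q_1,\dots,q_N,w_1,\dots,w_N$. $\mathbf{A}=[A\,|\,B]$ encodes the boundary condition $A\begin{pmatrix}y_0\\ f_0\Delta y_0\end{pmatrix}+B\begin{pmatrix}y_N\\ f_N\Delta y_N\end{pmatrix}=0$, where $A,B$ are complex $2\times2$ matrices with $\mathrm{rank}(A,B)=2$ and $AJA^*=BJB^*$, $J=\begin{pmatrix}0&1\\-1&0\end{pmatrix}$; $[A\,|\,B]$ is the class of $(A,B)$ modulo left multiplication by $GL(2,\mathbb{C})$, and $\mathcal{B}^{\mathbb{C}}$ is the set of all such classes. An eigenvalue of $(\boldsymbol\omega,\mathbf{A})$ is a $\lambda$ for which a nonzero $y$ solves the equation and the boundary condition. Eigenvalues are real and finite in number; they are counted with multiplicity (the dimension of the solution space) and listed as $\lambda_0\le\lambda_1\le\cdots$.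 Write $\hat{\mathbf{A}}=\left[\begin{array}{cccc}\hat a_{11}&\hat a_{12}&\hat b_{11}&\hat b_{12}\\ \hat a_{21}&\hat a_{22}&\hat b_{21}&\hat b_{22}\end{array}\right]$ (left half $A$, right half $B$), $\mu_1:=\hat a_{11}\hat b_{22}-\hat a_{21}\hat b_{12}$, $\mu_2:=\hat a_{22}\hat b_{12}-\hat a_{12}\hat b_{22}$. "Monotone in a coordinate direction" means monotone in that coordinate with all other coordinates fixed. *)

theory Defs
  imports
    "HOL-Analysis.Analysis"
    "HOL-Library.Function_Algebras"
    "HOL-Library.Multiset"
begin

text \<open>
  An equation is a triple (r, q, w), where r is the sequence 1/f, so that f n = 1 / r n.
  Sequences are set to 0 outside their index range. With this convention the product topology
  on triples of functions induces on the space of equations its topology as a subset of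
  the (3N+1)-dimensional Euclidean space.
\<close>

type_synonym equation = "(nat \<Rightarrow> real) \<times> (nat \<Rightarrow> real) \<times> (nat \<Rightarrow> real)"

definition equation_space :: "nat \<Rightarrow> equation set" where
  "equation_space N = {(r, q, w).
     (\<forall>n\<in>{0..N}. r n \<noteq> 0) \<and> (\<forall>n. n \<notin> {0..N} \<longrightarrow> r n = 0) \<and>
     (\<forall>n. n \<notin> {1..N} \<longrightarrow> q n = 0) \<and>
     (\<forall>n\<in>{1..N}. w n > 0) \<and> (\<forall>n. n \<notin> {1..N} \<longrightarrow> w n = 0)}"

definition fwd_diff :: "(nat \<Rightarrow> complex) \<Rightarrow> nat \<Rightarrow> complex" where
  "fwd_diff y n = y (n + 1) - y n"

definition bwd_diff :: "(nat \<Rightarrow> complex) \<Rightarrow> nat \<Rightarrow> complex" where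
  "bwd_diff y n = y n - y (n - 1)"

definition quasi_diff :: "(nat \<Rightarrow> real) \<Rightarrow> (nat \<Rightarrow> complex) \<Rightarrow> nat \<Rightarrow> complex" where
  "quasi_diff r y n = complex_of_real (1 / r n) * fwd_diff y n"

definition solves_equation :: "nat \<Rightarrow> equation \<Rightarrow> complex \<Rightarrow> (nat \<Rightarrow> complex) \<Rightarrow> bool" where
  "solves_equation N = (\<lambda>(r, q, w) lam y. \<forall>n\<in>{1..N}.
     - bwd_diff (quasi_diff r y) n + complex_of_real (q n) * y n
       = lam * complex_of_real (w n) * y n)"

type_synonym cmat2 = "complex ^ 2 ^ 2"

definition J2 :: cmat2 where
  "J2 = vector [vector [0, 1], vector [- 1, 0]]"

definition conj_transpose :: "cmat2 \<Rightarrow> cmat2" where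
  "conj_transpose A = transpose (map_matrix cnj A)"

definition hblock :: "cmat2 \<Rightarrow> cmat2 \<Rightarrow> complex ^ (2 + 2) ^ 2" where
  "hblock A B = (\<chi> i j. case j of Inl k \<Rightarrow> A $ i $ k | Inr k \<Rightarrow> B $ i $ k)"

definition self_adjoint_pair :: "cmat2 \<Rightarrow> cmat2 \<Rightarrow> bool" where
  "self_adjoint_pair A B \<longleftrightarrow>
     rank (hblock A B) = 2 \<and> A ** J2 ** conj_transpose A = B ** J2 ** conj_transpose B"

text \<open>The class [A | B] of (A, B) modulo left multiplication by GL(2, C).\<close>

definition bc_class :: "cmat2 \<Rightarrow> cmat2 \<Rightarrow> (cmat2 \<times> cmat2) set" where
  "bc_class A B = {(T ** A, T ** B) | T. invertible T}"

definition bc_space :: "(cmat2 \<times> cmat2) set set" where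
  "bc_space = {bc_class A B | A B. self_adjoint_pair A B}"

text \<open>
  The condition does not depend on the representative, so for a class it makes no difference
  whether one or all representatives are required to satisfy it.
\<close>

definition satisfies_bc ::
  "nat \<Rightarrow> equation \<Rightarrow> (cmat2 \<times> cmat2) set \<Rightarrow> (nat \<Rightarrow> complex) \<Rightarrow> bool" where
  "satisfies_bc N = (\<lambda>(r, q, w) bc y. \<forall>(A, B)\<in>bc.
     A *v vector [y 0, quasi_diff r y 0] + B *v vector [y N, quasi_diff r y N] = 0)"

text \<open>
  The sequences y = (y 0, ..., y (N+1)) are set to 0 beyond N+1; dimensions are taken
  in the complex vector space of all complex sequences.
\<close>

definition cseq_scale :: "complex \<Rightarrow> (nat \<Rightarrow> complex) \<Rightarrow> nat \<Rightarrow> complex" where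
  "cseq_scale c y = (\<lambda>n. c * y n)"

global_interpretation cseq: vector_space cseq_scale
  by unfold_locales (auto simp: cseq_scale_def fun_eq_iff algebra_simps)

definition eigenspace ::
  "nat \<Rightarrow> equation \<Rightarrow> (cmat2 \<times> cmat2) set \<Rightarrow> complex \<Rightarrow> (nat \<Rightarrow> complex) set" where
  "eigenspace N \<omega> bc lam =
     {y. (\<forall>n > N + 1. y n = 0) \<and> solves_equation N \<omega> lam y \<and> satisfies_bc N \<omega> bc y}"

definition eigenvalues :: "nat \<Rightarrow> equation \<Rightarrow> (cmat2 \<times> cmat2) set \<Rightarrow> complex set" where
  "eigenvalues N \<omega> bc = {lam. \<exists>y\<in>eigenspace N \<omega> bc lam. y \<noteq> 0}"

text \<open>
  The eigenvalues with multiplicity, as a multiset. This is meaningful only if the set of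
  eigenvalues is finite, as is the list of eigenvalues below only if they are real.
\<close>

definition eigenvalue_mset :: "nat \<Rightarrow> equation \<Rightarrow> (cmat2 \<times> cmat2) set \<Rightarrow> complex multiset" where
  "eigenvalue_mset N \<omega> bc =
     (\<Sum>lam\<in>eigenvalues N \<omega> bc. replicate_mset (cseq.dim (eigenspace N \<omega> bc lam)) lam)"

definition nth_eigenvalue ::
  "nat \<Rightarrow> equation \<Rightarrow> (cmat2 \<times> cmat2) set \<Rightarrow> nat \<Rightarrow> real" where
  "nth_eigenvalue N \<omega> bc n =
     sorted_list_of_multiset (image_mset Re (eigenvalue_mset N \<omega> bc)) ! n"

definition mu1 :: "cmat2 \<Rightarrow> cmat2 \<Rightarrow> complex" where
  "mu1 A B = A $ 1 $ 1 * B $ 2 $ 2 - A $ 2 $ 1 * B $ 1 $ 2"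

definition mu2 :: "cmat2 \<Rightarrow> cmat2 \<Rightarrow> complex" where
  "mu2 A B = A $ 2 $ 2 * B $ 1 $ 2 - A $ 1 $ 2 * B $ 2 $ 2"

end

theory Submission
  imports Defs "HOL-Computational_Algebra.Fundamental_Theorem_Algebra"
begin

text \<open>
  Under either assumption on \<open>\<mu>\<^sub>1, \<mu>\<^sub>2\<close> the determinant \<open>\<mu>\<^sub>2 + \<mu>\<^sub>1 / f\<^sub>0\<close> does not vanish, so the boundary
  condition determines \<open>f\<^sub>0 \<Delta> y\<^sub>0\<close> and \<open>f\<^sub>N \<Delta> y\<^sub>N\<close> as linear functions of \<open>y\<^sub>1\<close> and \<open>y\<^sub>N\<close>. Eliminating them
  turns the problem into a Hermitian pencil \<open>L y = \<lambda> W y\<close> in the \<open>N\<close> unknowns \<open>y\<^sub>1, \<dots>, y\<^sub>N\<close> with \<open>W\<close>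
  positive definite, which has exactly \<open>N\<close> real eigenvalues. By the Courant--Fischer principle,
  \<open>\<lambda>\<^sub>n < c\<close> iff the form of \<open>L - c W\<close> is negative definite on some subspace of dimension \<open>n + 1\<close>.
  Hence \<open>\<lambda>\<^sub>n\<close> inherits continuity and monotonicity from the quadratic form. The only term of the form
  for which monotonicity is not evident is the boundary term as a function of \<open>\<rho> = 1 / f\<^sub>0\<close>; if \<open>G\<^sub>\<rho>\<close> is
  this term and \<open>u\<^sub>\<rho>\<close> the value of \<open>f\<^sub>0 \<Delta> y\<^sub>0\<close>, the Lagrangian property of the boundary condition gives
  \<open>G\<^sub>\<sigma> - G\<^sub>\<rho> = (\<rho> - \<sigma>) u\<^sub>\<rho> cnj u\<^sub>\<sigma>\<close>, and \<open>u\<^sub>\<rho> cnj u\<^sub>\<sigma> \<ge> 0\<close> if \<open>\<rho>\<close> and \<open>\<sigma>\<close> have the same sign.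
\<close>

section \<open>Linear algebra and multisets\<close>

text \<open>Gaussian elimination of one equation: a pivot \<open>p\<close> removes equation
  \<open>k\<close> and one unknown, so the inequality of the counts survives; an equation without a
  pivot is dropped.\<close>

lemma underdetermined_system_solvable:
  fixes M :: "'i \<Rightarrow> 'k \<Rightarrow> 'f::field"
  assumes "finite K" "finite J" "card K < card J"
  shows "\<exists>a. (\<exists>i\<in>J. a i \<noteq> 0) \<and> (\<forall>k\<in>K. (\<Sum>i\<in>J. a i * M i k) = 0)"
  using assms
proof (induction K arbitrary: J M rule: finite_induct)
  case empty
  then obtain j where "j \<in> J" by fastforce
  then show ?case by (intro exI[of _ "\<lambda>_. 1"]) auto
next
  case (insert k K)
  show ?case
  proof (cases "\<forall>i\<in>J. M i k = 0")
    case True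
    then show ?thesis using insert by (auto simp: insert.prems)
  next
    case False
    then obtain p where p: "p \<in> J" "M p k \<noteq> 0" by blast
    have "card K < card (J - {p})"
      using insert p by (simp add: card_Diff_singleton)
    with insert.IH[of "J - {p}" "\<lambda>i l. M i l - M i k / M p k * M p l"] insert.prems
    obtain a where a: "\<exists>i\<in>J - {p}. a i \<noteq> 0"
      and eq: "\<And>l. l \<in> K \<Longrightarrow> (\<Sum>i\<in>J - {p}. a i * (M i l - M i k / M p k * M p l)) = 0"
      by auto
    \<comment> \<open>The value at \<open>p\<close> is the one that solves equation
      \<open>k\<close>; the remaining equations then become the reduced ones.\<close>
    define b where "b = a(p := - (\<Sum>i\<in>J - {p}. a i * M i k / M p k))"
    have split: "(\<Sum>i\<in>J. b i * M i l) = (\<Sum>i\<in>J - {p}. a i * (M i l - M i k / M p k * M p l))" for l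
    proof -
      have "(\<Sum>i\<in>J. b i * M i l) = b p * M p l + (\<Sum>i\<in>J - {p}. b i * M i l)"
        using p insert.prems by (simp add: sum.remove)
      also have "(\<Sum>i\<in>J - {p}. b i * M i l) = (\<Sum>i\<in>J - {p}. a i * M i l)"
        by (rule sum.cong) (auto simp: b_def)
      finally show ?thesis
        by (simp add: b_def sum_distrib_right sum_distrib_left sum_subtractf algebra_simps)
    qed
    have "(\<Sum>i\<in>J. b i * M i k) = 0"
      unfolding split using p by simp
    moreover have "\<exists>i\<in>J. b i \<noteq> 0"
      using a by (auto simp: b_def)
    ultimately show ?thesis using split eq by (intro exI[of _ b]) auto
  qed
qed

section \<open>Finite sums, multisets and order statistics\<close>

lemma sum_fun_apply: "(\<Sum>i\<in>J. f i) x = (\<Sum>i\<in>J. f i x)" for f :: "'i \<Rightarrow> 'a \<Rightarrow> 'b::comm_monoid_add"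
  by (induction J rule: infinite_finite_induct) auto

text \<open>Links the grouped form in which \<open>eigenvalue_mset\<close> is defined with the
  eigenvalues indexed by an eigenbasis.\<close>

lemma image_mset_mset_set_conv_sum:
  assumes "finite B"
  shows "image_mset f (mset_set B) = (\<Sum>x\<in>f ` B. replicate_mset (card {b\<in>B. f b = x}) x)"
proof (rule multiset_eqI)
  fix x
  have "count (\<Sum>x\<in>f ` B. replicate_mset (card {b\<in>B. f b = x}) x) x
      = (\<Sum>y\<in>f ` B. if y = x then card {b\<in>B. f b = x} else 0)"
    by (auto simp: count_sum intro!: sum.cong)
  also have "\<dots> = card {b\<in>B. f b = x}"
    using assms by (auto simp: sum.delta)
  finally show "count (image_mset f (mset_set B)) x
      = count (\<Sum>x\<in>f ` B. replicate_mset (card {b\<in>B. f b = x}) x) x"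
    using assms by (simp add: count_image_mset' Collect_conj_eq Int_commute) (simp add: Int_def conj_commute eq_commute)
qed

text \<open>The entries of a sorted list below \<open>c\<close> form an initial segment. This
  reduces the n-th eigenvalue to counting eigenvalues.\<close>

lemma nth_sorted_list_of_multiset_less_iff:
  fixes M :: "'a::linorder multiset"
  assumes "n < size M"
  shows "sorted_list_of_multiset M ! n < c \<longleftrightarrow> n < size (filter_mset (\<lambda>x. x < c) M)"
proof -
  define xs where "xs = sorted_list_of_multiset M"
  have M: "M = mset xs" and s: "sorted xs" by (simp_all add: xs_def)
  have n: "n < length xs" using assms by (simp add: M)
  have "size (filter_mset (\<lambda>x. x < c) M) = card {i. i < length xs \<and> xs ! i < c}"
    unfolding M by (simp add: length_filter_conv_card flip: mset_filter)
  moreover have "n < card {i. i < length xs \<and> xs ! i < c}" if "xs ! n < c"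
  proof -
    have "{..n} \<subseteq> {i. i < length xs \<and> xs ! i < c}"
      using n s that by (auto simp: sorted_iff_nth_mono intro: le_less_trans)
    from card_mono[OF _ this] show ?thesis by simp
  qed
  moreover have "card {i. i < length xs \<and> xs ! i < c} \<le> n" if "\<not> xs ! n < c"
  proof -
    have "{i. i < length xs \<and> xs ! i < c} \<subseteq> {..<n}"
    proof safe
      fix i assume i: "i < length xs" "xs ! i < c"
      show "i < n"
      proof (rule ccontr)
        assume "\<not> i < n"
        then have "xs ! n \<le> xs ! i" using s i by (simp add: sorted_iff_nth_mono)
        then show False using i that by simp
      qed
    qed
    from card_mono[OF _ this] show ?thesis by simp
  qed
  ultimately show ?thesis unfolding xs_def[symmetric] by linarith
qed

section \<open>Linear operators on sequences and polynomials in them\<close>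

lemma cseq_scale_apply: "cseq_scale c y n = c * y n"
  by (simp add: cseq_scale_def)

abbreviation comb :: "'i set \<Rightarrow> ('i \<Rightarrow> complex) \<Rightarrow> ('i \<Rightarrow> nat \<Rightarrow> complex) \<Rightarrow> nat \<Rightarrow> complex" where
  "comb J a g \<equiv> \<Sum>i\<in>J. cseq_scale (a i) (g i)"

lemma comb_apply: "comb J a g n = (\<Sum>i\<in>J. a i * g i n)"
  by (simp add: sum_fun_apply cseq_scale_def)

locale linear_operator =
  fixes T :: "(nat \<Rightarrow> complex) \<Rightarrow> nat \<Rightarrow> complex"
  assumes add: "T (x + y) = T x + T y"
    and scale: "T (cseq_scale c x) = cseq_scale c (T x)"
begin

lemma zero: "T 0 = 0"
  using scale[of 0 0] by (simp add: cseq_scale_def zero_fun_def)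

lemma comb: "T (comb J a g) = comb J a (\<lambda>i. T (g i))"
  by (induction J rule: infinite_finite_induct)
    (simp_all only: sum.infinite sum.empty sum.insert zero add scale not_False_eq_True)

definition apply_poly :: "complex poly \<Rightarrow> (nat \<Rightarrow> complex) \<Rightarrow> nat \<Rightarrow> complex" where
  "apply_poly p v = comb {..degree p} (coeff p) (\<lambda>i. (T ^^ i) v)"

lemma apply_poly_altdef:
  assumes "degree p \<le> d"
  shows "apply_poly p v = comb {..d} (coeff p) (\<lambda>i. (T ^^ i) v)"
  unfolding apply_poly_def
  by (rule sum.mono_neutral_left) (use assms in \<open>auto simp: coeff_eq_0\<close>)

text \<open>Multiplication by the variable shifts the coefficients, which matches one more
  application of \<open>T\<close>. All sums are extended to \<open>Suc d\<close> to compare them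
  term by term.\<close>

lemma apply_poly_linear_factor:
  "apply_poly ([:- z, 1:] * q) v = T (apply_poly q v) - cseq_scale z (apply_poly q v)"
proof -
  define d where "d = degree q"
  have "degree ([:- z, 1:] * q) \<le> Suc d"
    using degree_mult_le[of "[:- z, 1:]" q] by (simp add: d_def)
  then have 1: "apply_poly ([:- z, 1:] * q) v
      = comb {..Suc d} (coeff ([:- z, 1:] * q)) (\<lambda>i. (T ^^ i) v)"
    by (rule apply_poly_altdef)
  have 2: "cseq_scale z (apply_poly q v)
      = cseq_scale z (comb {..Suc d} (coeff q) (\<lambda>i. (T ^^ i) v))"
    by (subst apply_poly_altdef[of q "Suc d"]) (auto simp: d_def)
  have 3: "T (apply_poly q v) = comb {..d} (coeff q) (\<lambda>i. (T ^^ Suc i) v)"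
    by (simp add: apply_poly_def comb d_def)
  have 4: "comb {..Suc d} (coeff (pCons 0 q)) (\<lambda>i. (T ^^ i) v)
      = comb {..d} (coeff q) (\<lambda>i. (T ^^ Suc i) v)"
    by (subst sum.atMost_Suc_shift) simp
  show ?thesis
    unfolding 1 2 3 4[symmetric]
  proof (rule ext, unfold minus_apply cseq_scale_apply comb_apply)
    fix n
    show "(\<Sum>i\<le>Suc d. coeff ([:- z, 1:] * q) i * (T ^^ i) v n)
        = (\<Sum>i\<le>Suc d. coeff (pCons 0 q) i * (T ^^ i) v n)
          - z * (\<Sum>i\<le>Suc d. coeff q i * (T ^^ i) v n)"
      unfolding sum_distrib_left sum_subtractf[symmetric]
      by (rule sum.cong) (simp_all add: algebra_simps)
  qed
qed

text \<open>Split off a complex root, \<open>p = [:- z, 1:] * q\<close>. Either \<open>q\<close>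
  already annihilates \<open>v\<close> and the degree drops, or \<open>apply_poly q v\<close> is a
  nonzero vector killed by \<open>T - z\<close>; it lies in \<open>U\<close> by invariance.\<close>

lemma eigenvector_of_annihilating_poly:
  assumes "p \<noteq> 0" "apply_poly p v = 0" "v \<noteq> 0"
    and "v \<in> U" "cseq.subspace U" "\<And>x. x \<in> U \<Longrightarrow> T x \<in> U"
  shows "\<exists>x\<in>U. \<exists>z. x \<noteq> 0 \<and> T x = cseq_scale z x"
  using assms(1,2)
proof (induction "degree p" arbitrary: p)
  case 0
  then obtain c where "p = [:c:]" "c \<noteq> 0" by (metis degree_eq_zeroE pCons_eq_0_iff)
  then show ?case using 0 assms(3) by (auto simp: apply_poly_def cseq_scale_def fun_eq_iff)
next
  case (Suc d)
  then have "\<not> constant (poly p)" by (simp add: constant_degree)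
  then obtain z where "poly p z = 0" using fundamental_theorem_of_algebra by blast
  then obtain q where q: "p = [:- z, 1:] * q" by (metis dvdE poly_eq_0_iff_dvd)
  then have "q \<noteq> 0" using Suc by auto
  then have "degree q = d" using Suc q by (simp add: degree_mult_eq del: mult_pCons_left)
  show ?case
  proof (cases "apply_poly q v = 0")
    case True
    then show ?thesis using Suc \<open>q \<noteq> 0\<close> \<open>degree q = d\<close> by blast
  next
    case False
    have "(T ^^ i) v \<in> U" for i by (induction i) (use assms in auto)
    then have "apply_poly q v \<in> U"
      unfolding apply_poly_def using assms(5)
      by (intro cseq.subspace_sum cseq.subspace_scale) auto
    moreover have "T (apply_poly q v) = cseq_scale z (apply_poly q v)"
      using Suc.prems(2) unfolding q apply_poly_linear_factor by simp
    ultimately show ?thesis using False by blast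
  qed
qed

end

section \<open>Self-adjoint operators\<close>

text \<open>The weight sits in the inner product, so that a pencil
  \<open>L y = \<lambda> W y\<close> becomes the ordinary eigenvalue problem of
  \<open>W^-1 L\<close>.\<close>

locale self_adjoint_operator = linear_operator T for T +
  fixes I :: "nat set" and w :: "nat \<Rightarrow> real"
  assumes finite_I: "finite I"
    and w_pos: "n \<in> I \<Longrightarrow> w n > 0"
    and outside: "n \<notin> I \<Longrightarrow> T x n = 0"
    and self_adjoint: "(\<Sum>n\<in>I. of_real (w n) * T x n * cnj (y n))
      = (\<Sum>n\<in>I. of_real (w n) * x n * cnj (T y n))"
begin

section \<open>The weighted inner product and existence of eigenvectors\<close>

definition V :: "(nat \<Rightarrow> complex) set" where
  "V = {y. \<forall>n. n \<notin> I \<longrightarrow> y n = 0}"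

definition wprod :: "(nat \<Rightarrow> complex) \<Rightarrow> (nat \<Rightarrow> complex) \<Rightarrow> complex" where
  "wprod x y = (\<Sum>n\<in>I. of_real (w n) * x n * cnj (y n))"

definition mass :: "(nat \<Rightarrow> complex) \<Rightarrow> real" where
  "mass x = (\<Sum>n\<in>I. w n * (cmod (x n))\<^sup>2)"

text \<open>The Rayleigh quotient. On an eigenvector it is the eigenvalue, which thus becomes a
  function of the vector alone.\<close>

definition eig :: "(nat \<Rightarrow> complex) \<Rightarrow> real" where
  "eig x = Re (wprod (T x) x) / mass x"

lemma subspace_V: "cseq.subspace V"
  by (rule cseq.subspaceI) (auto simp: V_def cseq_scale_def)

lemma T_in_V: "T x \<in> V"
  using outside by (auto simp: V_def)

lemma wprod_left [simp]:
  "wprod 0 y = 0" "wprod (x + x') y = wprod x y + wprod x' y"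
  "wprod (x - x') y = wprod x y - wprod x' y" "wprod (cseq_scale c x) y = c * wprod x y"
  by (simp_all add: wprod_def cseq_scale_def algebra_simps sum.distrib sum_subtractf sum_distrib_left)

lemma cnj_wprod: "cnj (wprod x y) = wprod y x"
  by (simp add: wprod_def mult.commute mult.left_commute)

lemma wprod_comb_left: "wprod (comb J a g) y = (\<Sum>i\<in>J. a i * wprod (g i) y)"
  by (induction J rule: infinite_finite_induct)
    (simp_all only: sum.infinite sum.empty sum.insert wprod_left not_False_eq_True)

lemma wprod_comb_right: "wprod x (comb J a g) = (\<Sum>i\<in>J. cnj (a i) * wprod x (g i))"
proof -
  have "wprod x (comb J a g) = cnj (\<Sum>i\<in>J. a i * wprod (g i) x)"
    by (simp only: flip: wprod_comb_left cnj_wprod[of "comb J a g" x])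
  then show ?thesis by (simp add: cnj_wprod)
qed

lemma wprod_self: "wprod x x = of_real (mass x)"
  unfolding wprod_def mass_def of_real_sum
  by (rule sum.cong) (simp_all add: complex_norm_square mult.assoc flip: of_real_power)

lemma wprod_T: "wprod (T x) y = wprod x (T y)"
  using self_adjoint by (simp add: wprod_def)

lemma mass_pos:
  assumes "x \<in> V" "x \<noteq> 0"
  shows "mass x > 0"
proof -
  obtain n where "x n \<noteq> 0" using assms(2) by (auto simp: fun_eq_iff)
  moreover from this have "n \<in> I" using assms(1) by (auto simp: V_def)
  ultimately show ?thesis unfolding mass_def
    by (intro sum_pos2[OF finite_I]) (auto simp: w_pos less_imp_le)
qed

text \<open>Pairing \<open>T x\<close> with \<open>x\<close> gives \<open>z\<close> times the mass,
  and self-adjointness makes this pairing real.\<close>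

lemma eigenvalue_eq_eig:
  assumes "x \<in> V" "x \<noteq> 0" "T x = cseq_scale z x"
  shows "z = of_real (eig x)"
proof -
  have m: "mass x > 0" using assms mass_pos by auto
  have "z * of_real (mass x) = wprod (T x) x" using assms by (simp add: wprod_self)
  moreover have "cnj (wprod (T x) x) = wprod (T x) x" by (simp add: cnj_wprod wprod_T)
  then have "wprod (T x) x = of_real (Re (wprod (T x) x))"
    by (metis Reals_cnj_iff of_real_Re)
  ultimately show ?thesis using m
    by (simp add: eig_def field_simps)
qed

text \<open>The first \<open>card I + 1\<close> of the vectors \<open>v, T v, T (T v), ...\<close>
  live on \<open>card I\<close> coordinates, hence satisfy a nontrivial relation; its coefficients
  form a polynomial annihilating \<open>v\<close>.\<close>

lemma eigenvector_exists:
  assumes U: "cseq.subspace U" "U \<subseteq> V" "\<And>x. x \<in> U \<Longrightarrow> T x \<in> U" and v: "v \<in> U" "v \<noteq> 0"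
  shows "\<exists>x\<in>U. x \<noteq> 0 \<and> T x = cseq_scale (of_real (eig x)) x"
proof -
  obtain a where a: "\<exists>i\<in>{..card I}. a i \<noteq> 0"
    "\<forall>k\<in>I. (\<Sum>i\<in>{..card I}. a i * (T ^^ i) v k) = 0"
    using underdetermined_system_solvable[of I "{..card I}" "\<lambda>i k. (T ^^ i) v k"] finite_I by auto
  define p where "p = (\<Sum>i\<le>card I. monom (a i) i)"
  have coeff: "coeff p i = (if i \<le> card I then a i else 0)" for i
    by (auto simp: p_def coeff_sum)
  have "p \<noteq> 0" using a(1) coeff by (metis atMost_iff coeff_0)
  moreover have "apply_poly p v = 0"
  proof (rule ext)
    fix k
    have "(T ^^ i) v \<in> U" for i by (induction i) (use U v in auto)
    then have "(T ^^ i) v k = 0" if "k \<notin> I" for i using U(2) that by (auto simp: V_def)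
    moreover have "degree p \<le> card I" by (rule degree_le) (simp add: coeff)
    ultimately show "apply_poly p v k = 0 k"
      using a(2) by (cases "k \<in> I") (simp_all add: apply_poly_altdef comb_apply coeff)
  qed
  ultimately obtain x z where "x \<in> U" "x \<noteq> 0" "T x = cseq_scale z x"
    using eigenvector_of_annihilating_poly[of p v U] U v by blast
  with eigenvalue_eq_eig[of x z] U(2) show ?thesis by auto
qed

definition eigensystem :: "(nat \<Rightarrow> complex) set \<Rightarrow> bool" where
  "eigensystem B \<longleftrightarrow> B \<subseteq> V \<and> 0 \<notin> B \<and> pairwise (\<lambda>x y. wprod x y = 0) B \<and>
     (\<forall>x\<in>B. T x = cseq_scale (of_real (eig x)) x)"

text \<open>Pairing a vanishing combination with one of its members isolates that coefficient times
  a positive mass.\<close>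

lemma orthogonal_independent:
  assumes "B \<subseteq> V" "0 \<notin> B" "pairwise (\<lambda>x y. wprod x y = 0) B"
  shows "cseq.independent B"
  unfolding cseq.independent_explicit_finite_subsets
proof (intro allI impI ballI)
  fix S u x assume S: "S \<subseteq> B" "finite S" "comb S u (\<lambda>v. v) = 0" "x \<in> S"
  have "0 = wprod (comb S u (\<lambda>v. v)) x" using S by simp
  also have "\<dots> = (\<Sum>v\<in>S. u v * wprod v x)" by (rule wprod_comb_left)
  also have "\<dots> = (\<Sum>v\<in>S. if v = x then u x * wprod x x else 0)"
    using S assms(3) by (intro sum.cong) (auto simp: pairwise_def)
  also have "\<dots> = u x * wprod x x" using S by simp
  finally have "u x * of_real (mass x) = 0" by (simp add: wprod_self)
  moreover have "x \<in> V" "x \<noteq> 0" using S assms by auto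
  then have "mass x > 0" by (rule mass_pos)
  ultimately show "u x = 0" by simp
qed

lemma V_subset_span_units: "V \<subseteq> cseq.span ((\<lambda>i n. if n = i then 1 else 0) ` I)"
proof
  fix x assume "x \<in> V"
  then have "x = comb I x (\<lambda>i n. if n = i then 1 else 0)"
    using finite_I by (auto simp: V_def fun_eq_iff comb_apply if_distrib[of "\<lambda>t. _ * t"] cong: if_cong)
  also have "\<dots> \<in> cseq.span ((\<lambda>i n. if n = i then 1 else 0) ` I)"
    by (intro cseq.span_sum cseq.span_scale cseq.span_base) auto
  finally show "x \<in> cseq.span ((\<lambda>i n. if n = i then 1 else 0) ` I)" .
qed

lemma independent_in_V:
  assumes "B \<subseteq> V" "cseq.independent B"
  shows "finite B \<and> card B \<le> card I"
  using cseq.independent_span_bound[of "(\<lambda>i n. if n = i then 1 else 0) ` I" B]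
    assms V_subset_span_units finite_I card_image_le[OF finite_I] by (meson finite_imageI order_trans)

lemma eigensystem_finite:
  assumes "eigensystem B"
  shows "finite B" "card B \<le> card I"
  using assms independent_in_V orthogonal_independent unfolding eigensystem_def by blast+

text \<open>The right side is the orthogonal projection of \<open>x\<close>. The remainder is
  orthogonal to \<open>B\<close>, so the completeness assumption \<open>S\<close> makes it
  zero.\<close>

lemma eigensystem_expansion:
  assumes B: "eigensystem B" and S: "\<And>x. x \<in> V \<Longrightarrow> \<forall>b\<in>B. wprod x b = 0 \<Longrightarrow> x = 0" and x: "x \<in> V"
  shows "x = comb B (\<lambda>b. wprod x b / of_real (mass b)) (\<lambda>b. b)"
proof -
  let ?y = "comb B (\<lambda>b. wprod x b / of_real (mass b)) (\<lambda>b. b)"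
  note fin = eigensystem_finite(1)[OF B]
  have "wprod ?y b = wprod x b" if "b \<in> B" for b
  proof -
    have "mass b > 0" using that B mass_pos[of b] by (auto simp: eigensystem_def)
    have "wprod ?y b = (\<Sum>c\<in>B. if c = b then wprod x b else 0)"
      unfolding wprod_comb_left using that B \<open>mass b > 0\<close>
      by (intro sum.cong) (auto simp: wprod_self eigensystem_def pairwise_def)
    with fin that show ?thesis by simp
  qed
  moreover have "?y \<in> V"
    using B subspace_V by (intro cseq.subspace_sum cseq.subspace_scale) (auto simp: eigensystem_def)
  ultimately have "x - ?y = 0"
    using x subspace_V by (intro S) (auto simp: cseq.subspace_diff)
  then show ?thesis by simp
qed

definition complete_eigensystem :: "(nat \<Rightarrow> complex) set \<Rightarrow> bool" where
  "complete_eigensystem B \<longleftrightarrow> eigensystem B \<and> (\<forall>x\<in>V. (\<forall>b\<in>B. wprod x b = 0) \<longrightarrow> x = 0)"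

text \<open>
  A largest eigensystem is complete: its orthogonal complement is invariant, so if it were
  nonzero, it would contain a further eigenvector.
\<close>

lemma complete_eigensystem_exists: "\<exists>B. complete_eigensystem B"
proof -
  have "eigensystem {}" by (simp add: eigensystem_def)
  moreover have "\<forall>B. eigensystem B \<longrightarrow> card B < Suc (card I)"
    using eigensystem_finite(2) by (simp add: less_Suc_eq_le)
  ultimately obtain B where B: "eigensystem B"
    and max: "\<And>B'. eigensystem B' \<Longrightarrow> card B' \<le> card B"
    using ex_has_greatest_nat[of eigensystem "{}" card "Suc (card I)"]
    by (auto simp: less_imp_le)
  define U where "U = {x\<in>V. \<forall>b\<in>B. wprod x b = 0}"
  have U: "cseq.subspace U"
    using subspace_V by (auto simp: U_def cseq.subspace_def)
  have inv: "T x \<in> U" if "x \<in> U" for x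
  proof -
    have "wprod (T x) b = 0" if b: "b \<in> B" for b
    proof -
      have "wprod (T x) b = cnj (wprod (T b) x)" by (simp add: wprod_T cnj_wprod)
      also have "T b = cseq_scale (of_real (eig b)) b" using B b by (simp add: eigensystem_def)
      also have "cnj (wprod (cseq_scale (of_real (eig b)) b) x) = of_real (eig b) * wprod x b"
        by (simp add: cnj_wprod)
      finally show ?thesis using \<open>x \<in> U\<close> b by (simp add: U_def)
    qed
    then show ?thesis by (simp add: U_def T_in_V)
  qed
  have "x = 0" if x: "x \<in> U" for x
  proof (rule ccontr)
    assume "x \<noteq> 0"
    then obtain y where y: "y \<in> U" "y \<noteq> 0" "T y = cseq_scale (of_real (eig y)) y"
      using eigenvector_exists[of U x] U inv x unfolding U_def by blast
    have orth: "wprod y b = 0" "wprod b y = 0" if "b \<in> B" for b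
      using y that cnj_wprod[of y b] by (auto simp: U_def)
    have "y \<notin> B" using y orth(1)[of y] mass_pos[of y] by (auto simp: U_def wprod_self)
    moreover have "eigensystem (insert y B)"
      using B y orth by (auto simp: eigensystem_def pairwise_insert U_def)
    ultimately show False
      using max[of "insert y B"] eigensystem_finite(1)[OF B] by simp
  qed
  then show ?thesis using B by (auto simp: complete_eigensystem_def U_def)
qed

text \<open>The form vanishes at the zero vector, so strict negativity makes the first
  \<open>m\<close> vectors independent: such a family encodes an \<open>m\<close>-dimensional
  subspace on which \<open>T - c\<close> is negative definite.\<close>

definition negative_family :: "real \<Rightarrow> nat \<Rightarrow> (nat \<Rightarrow> nat \<Rightarrow> complex) \<Rightarrow> bool" where
  "negative_family c m v \<longleftrightarrow> (\<forall>i. v i \<in> V) \<and> (\<forall>a. (\<exists>i<m. a i \<noteq> 0) \<longrightarrow>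
    Re (wprod (T (comb {..<m} a v)) (comb {..<m} a v)) - c * mass (comb {..<m} a v) < 0)"

section \<open>Spectral decomposition and the Courant-Fischer principle\<close>

context
  fixes B assumes complete: "complete_eigensystem B"
begin

lemma eigensystem: "eigensystem B"
  using complete by (simp add: complete_eigensystem_def)

lemma finite_B: "finite B"
  by (rule eigensystem_finite(1)[OF eigensystem])

lemma expansion:
  assumes "x \<in> V"
  shows "x = comb B (\<lambda>b. wprod x b / of_real (mass b)) (\<lambda>b. b)"
  using eigensystem_expansion[OF eigensystem _ assms] complete
  by (auto simp: complete_eigensystem_def)

text \<open>The unit vectors at the points of \<open>I\<close> are independent by orthogonality, and
  \<open>B\<close> spans \<open>V\<close>.\<close>

lemma card_B: "card B = card I"
proof (rule antisym)
  show "card B \<le> card I" by (rule eigensystem_finite(2)[OF eigensystem])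
  define e where "e = (\<lambda>i n::nat. if n = i then 1 else (0::complex))"
  have e: "e ` I \<subseteq> V" by (auto simp: e_def V_def)
  have "inj_on e I" by (auto simp: inj_on_def e_def fun_eq_iff split: if_splits)
  have "e i i \<noteq> 0" for i by (simp add: e_def)
  then have 0: "0 \<notin> e ` I" by (metis imageE zero_fun_apply)
  have "wprod (e i) (e j) = 0" if "i \<noteq> j" for i j
    using that by (auto simp: wprod_def e_def intro!: sum.neutral)
  then have "pairwise (\<lambda>x y. wprod x y = 0) (e ` I)"
    by (simp add: pairwise_def) metis
  from orthogonal_independent[OF e 0 this] have "cseq.independent (e ` I)" .
  moreover have "V \<subseteq> cseq.span B"
  proof
    fix x assume "x \<in> V"
    show "x \<in> cseq.span B"
      by (subst expansion[OF \<open>x \<in> V\<close>]) (intro cseq.span_sum cseq.span_scale cseq.span_base)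
  qed
  ultimately have "card (e ` I) \<le> card B"
    using cseq.independent_span_bound[OF finite_B] e by blast
  then show "card I \<le> card B" using \<open>inj_on e I\<close> by (simp add: card_image)
qed

text \<open>Self-adjointness makes \<open>y\<close> orthogonal to all members of \<open>B\<close>
  with another eigenvalue, so these drop out of its expansion.\<close>

lemma eigenspace_basis:
  assumes "y \<in> V" "T y = cseq_scale z y"
  shows "y \<in> cseq.span {b\<in>B. of_real (eig b) = z}"
proof -
  have zero: "wprod y b = 0" if b: "b \<in> B" "of_real (eig b) \<noteq> z" for b
  proof -
    have "z * wprod y b = wprod (T y) b" using assms by simp
    also have "\<dots> = cnj (wprod (T b) y)" by (simp add: wprod_T cnj_wprod)
    also have "T b = cseq_scale (of_real (eig b)) b"
      using eigensystem b by (simp add: eigensystem_def)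
    also have "cnj (wprod (cseq_scale (of_real (eig b)) b) y) = of_real (eig b) * wprod y b"
      by (simp add: cnj_wprod)
    finally show ?thesis using b by simp
  qed
  have "cseq_scale (wprod y b / of_real (mass b)) b \<in> cseq.span {b\<in>B. of_real (eig b) = z}"
    if "b \<in> B" for b
  proof (cases "of_real (eig b) = z")
    case True
    with that show ?thesis by (intro cseq.span_scale cseq.span_base) simp
  next
    case False
    with zero[OF that] show ?thesis by (simp add: cseq.span_zero)
  qed
  then show ?thesis
    by (subst expansion[OF assms(1)]) (rule cseq.span_sum)
qed

lemma eigenvector_in_B:
  assumes "b \<in> B"
  shows "b \<in> V" "b \<noteq> 0" "T b = cseq_scale (of_real (eig b)) b"
  using eigensystem assms by (auto simp: eigensystem_def)

lemma dim_eigenspace: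
  "cseq.dim {y\<in>V. T y = cseq_scale z y} = card {b\<in>B. of_real (eig b) = z}"
proof (rule cseq.dim_unique[OF _ _ _ refl])
  show "{b\<in>B. of_real (eig b) = z} \<subseteq> {y\<in>V. T y = cseq_scale z y}"
    using eigenvector_in_B by auto
  show "{y\<in>V. T y = cseq_scale z y} \<subseteq> cseq.span {b\<in>B. of_real (eig b) = z}"
    using eigenspace_basis by auto
  have "pairwise (\<lambda>x y. wprod x y = 0) {b\<in>B. of_real (eig b) = z}"
    using eigensystem by (auto simp: eigensystem_def pairwise_def)
  then show "cseq.independent {b\<in>B. of_real (eig b) = z}"
    using eigensystem by (intro orthogonal_independent) (auto simp: eigensystem_def)
qed

lemma eigenvalues_eq:
  "{z. \<exists>y\<in>V. y \<noteq> 0 \<and> T y = cseq_scale z y} = (\<lambda>b. of_real (eig b)) ` B"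
proof safe
  fix z y assume y: "y \<in> V" "y \<noteq> 0" "T y = cseq_scale z y"
  have "{b\<in>B. of_real (eig b) = z} \<noteq> {}"
    using eigenspace_basis[OF y(1,3)] y(2) by (metis cseq.span_empty singletonD)
  then show "z \<in> (\<lambda>b. of_real (eig b)) ` B" by auto
qed (use eigenvector_in_B in blast)

text \<open>Orthogonality removes the cross terms. The indexing by \<open>g\<close> covers both a
  finite list of eigenvectors and the whole of \<open>B\<close>.\<close>

lemma shifted_form_comb:
  assumes "finite J" "inj_on g J" "g ` J \<subseteq> B"
  shows "Re (wprod (T (comb J a g)) (comb J a g)) - c * mass (comb J a g)
    = (\<Sum>i\<in>J. (eig (g i) - c) * (cmod (a i))\<^sup>2 * mass (g i))"
proof -
  define x where "x = comb J a g"
  have orth0: "wprod (g j) (g i) = 0" if "i \<in> J" "j \<in> J" "j \<noteq> i" for i j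
    using that assms eigensystem
    unfolding eigensystem_def pairwise_def inj_on_def image_subset_iff by blast
  have orth: "wprod x (g i) = a i * of_real (mass (g i))" if "i \<in> J" for i
  proof -
    have "wprod x (g i) = (\<Sum>j\<in>J. if j = i then a i * of_real (mass (g i)) else 0)"
      unfolding x_def wprod_comb_left using that orth0
      by (intro sum.cong) (auto simp: wprod_self)
    then show ?thesis using that assms by simp
  qed
  have Tx: "T x = comb J (\<lambda>i. a i * of_real (eig (g i))) g"
    unfolding x_def comb
  proof (rule sum.cong)
    fix i assume "i \<in> J"
    then have "T (g i) = cseq_scale (of_real (eig (g i))) (g i)"
      using assms by (intro eigenvector_in_B(3)) auto
    then show "cseq_scale (a i) (T (g i)) = cseq_scale (a i * of_real (eig (g i))) (g i)" by simp
  qed simp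
  have "wprod (T x) x = wprod x (T x)" by (rule wprod_T)
  also have "\<dots> = (\<Sum>i\<in>J. cnj (a i * of_real (eig (g i))) * wprod x (g i))"
    unfolding Tx by (rule wprod_comb_right)
  also have "\<dots> = (\<Sum>i\<in>J. of_real (eig (g i) * (cmod (a i))\<^sup>2 * mass (g i)))"
    unfolding of_real_mult complex_norm_square
    by (rule sum.cong) (simp_all add: orth algebra_simps)
  finally have 1: "Re (wprod (T x) x) = (\<Sum>i\<in>J. eig (g i) * (cmod (a i))\<^sup>2 * mass (g i))"
    by simp
  have "of_real (mass x) = wprod x (comb J a g)" by (simp only: wprod_self x_def)
  also have "\<dots> = (\<Sum>i\<in>J. cnj (a i) * wprod x (g i))"
    by (rule wprod_comb_right)
  also have "\<dots> = (\<Sum>i\<in>J. of_real ((cmod (a i))\<^sup>2 * mass (g i)))"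
    unfolding of_real_mult complex_norm_square
    by (rule sum.cong) (simp_all add: orth algebra_simps)
  finally have 2: "mass x = (\<Sum>i\<in>J. (cmod (a i))\<^sup>2 * mass (g i))"
    unfolding of_real_sum[symmetric] of_real_eq_iff .
  show ?thesis
    unfolding x_def[symmetric] 1 2 sum_distrib_left sum_subtractf[symmetric]
    by (rule sum.cong) (simp_all add: algebra_simps)
qed

text \<open>Courant-Fischer in counting form. Eigenvectors below \<open>c\<close> give a negative
  family. If there are fewer than \<open>m\<close> of them, some nontrivial combination of any
  \<open>m\<close> vectors of \<open>V\<close> is orthogonal to them all, and there the form is
  nonnegative.\<close>

lemma le_card_eig_less_iff: "m \<le> card {b\<in>B. eig b < c} \<longleftrightarrow> (\<exists>v. negative_family c m v)"
proof
  assume "m \<le> card {b\<in>B. eig b < c}"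
  then obtain S where S: "S \<subseteq> {b\<in>B. eig b < c}" "card S = m" "finite S"
    by (rule obtain_subset_with_card_n)
  obtain g where g: "bij_betw g {..<m} S"
    using ex_bij_betw_nat_finite[OF S(3)] S(2) by (auto simp: lessThan_atLeast0)
  \<comment> \<open>\<open>negative_family\<close> constrains every index, so the family is
    continued by 0 from \<open>m\<close> on.\<close>
  define v where "v = (\<lambda>i. if i < m then g i else 0)"
  have v: "inj_on v {..<m}" "v ` {..<m} = S"
    using g by (auto simp: v_def bij_betw_def inj_on_def)
  have "negative_family c m v"
    unfolding negative_family_def
  proof (intro conjI allI impI)
    fix i show "v i \<in> V"
    proof (cases "i < m")
      case True
      then have "v i \<in> B" using v(2) S by auto
      then show ?thesis by (rule eigenvector_in_B)
    qed (simp add: v_def cseq.subspace_0[OF subspace_V])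
  next
    fix a :: "nat \<Rightarrow> complex" assume "\<exists>i<m. a i \<noteq> 0"
    then obtain k where k: "k < m" "a k \<noteq> 0" by blast
    have vi: "v i \<in> B" "eig (v i) < c" "mass (v i) > 0" if "i < m" for i
    proof -
      have "v i \<in> S" using that v(2) by auto
      then show vB: "v i \<in> B" and "eig (v i) < c" using S by auto
      show "mass (v i) > 0" using eigenvector_in_B[OF vB] by (intro mass_pos)
    qed
    have "0 < (\<Sum>i<m. (c - eig (v i)) * (cmod (a i))\<^sup>2 * mass (v i))"
      using k vi by (intro sum_pos2[of _ k]) (auto simp: less_imp_le)
    then show "Re (wprod (T (comb {..<m} a v)) (comb {..<m} a v)) - c * mass (comb {..<m} a v) < 0"
      using v(1) vi(1) by (subst shifted_form_comb) (auto simp: algebra_simps sum_subtractf)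
  qed
  then show "\<exists>v. negative_family c m v" by blast
next
  assume "\<exists>v. negative_family c m v"
  then obtain v where v: "\<And>i. v i \<in> V"
    and neg: "\<And>a. \<exists>i<m. a i \<noteq> 0 \<Longrightarrow>
      Re (wprod (T (comb {..<m} a v)) (comb {..<m} a v)) - c * mass (comb {..<m} a v) < 0"
    unfolding negative_family_def by blast
  show "m \<le> card {b\<in>B. eig b < c}"
  proof (rule ccontr)
    assume less: "\<not> ?thesis"
    have "finite {b\<in>B. eig b < c}" using finite_B by simp
    moreover have "card {b\<in>B. eig b < c} < card {..<m}" using less by simp
    ultimately have "\<exists>a. (\<exists>i\<in>{..<m}. a i \<noteq> 0) \<and>
        (\<forall>b\<in>{b\<in>B. eig b < c}. (\<Sum>i\<in>{..<m}. a i * wprod (v i) b) = 0)"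
      by (intro underdetermined_system_solvable) auto
    then obtain a where a: "\<exists>i\<in>{..<m}. a i \<noteq> 0"
      and orth: "\<forall>b\<in>{b\<in>B. eig b < c}. (\<Sum>i\<in>{..<m}. a i * wprod (v i) b) = 0"
      by blast
    define x where "x = comb {..<m} a v"
    have "x \<in> V" unfolding x_def using v subspace_V
      by (intro cseq.subspace_sum cseq.subspace_scale) auto
    define d where "d = (\<lambda>b. wprod x b / of_real (mass b))"
    have d0: "d b = 0" if "b \<in> B" "eig b < c" for b
      using orth that unfolding d_def x_def wprod_comb_left by simp
    have x: "x = comb B d (\<lambda>b. b)" unfolding d_def by (rule expansion[OF \<open>x \<in> V\<close>])
    have "Re (wprod (T x) x) - c * mass x = (\<Sum>b\<in>B. (eig b - c) * (cmod (d b))\<^sup>2 * mass b)"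
      unfolding x by (rule shifted_form_comb) (auto simp: finite_B)
    also have "\<dots> \<ge> 0"
    proof (rule sum_nonneg)
      fix b assume b: "b \<in> B"
      then have "mass b > 0" using eigenvector_in_B[of b] by (intro mass_pos)
      then show "0 \<le> (eig b - c) * (cmod (d b))\<^sup>2 * mass b"
        using d0[OF b] by (cases "eig b < c") auto
    qed
    finally have "\<not> Re (wprod (T x) x) - c * mass x < 0" by simp
    with neg[of a] a show False unfolding x_def by blast
  qed
qed

end

end

section \<open>Boundary conditions\<close>

definition bc_holds :: "cmat2 \<Rightarrow> cmat2 \<Rightarrow> complex \<Rightarrow> complex \<Rightarrow> complex \<Rightarrow> complex \<Rightarrow> bool" where
  "bc_holds A B y0 u0 yN uN \<longleftrightarrow>
     (\<forall>i. A $ i $ 1 * y0 + A $ i $ 2 * u0 + B $ i $ 1 * yN + B $ i $ 2 * uN = 0)"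

lemma matrix_vector_mult_eq_bc_holds:
  "A *v vector [y0, u0] + B *v vector [yN, uN] = 0 \<longleftrightarrow> bc_holds A B y0 u0 yN uN"
  by (simp add: vec_eq_iff bc_holds_def matrix_vector_mult_def sum_2 vector_2 add.assoc)

lemma mem_bc_class: "(A, B) \<in> bc_class A B"
proof -
  have "invertible (mat 1 :: cmat2)" by (simp add: invertible_def)
  then show ?thesis
    unfolding bc_class_def by (auto intro!: exI[of _ "mat 1"])
qed

text \<open>For \<open>(T ** A, T ** B)\<close> the condition is that of \<open>(A, B)\<close>
  multiplied by \<open>T\<close>, and \<open>(A, B)\<close> itself is in the class.\<close>

lemma satisfies_bc_class_iff:
  "satisfies_bc N (r, q, w) (bc_class A B) y \<longleftrightarrow>
     bc_holds A B (y 0) (quasi_diff r y 0) (y N) (quasi_diff r y N)"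
proof -
  let ?x = "vector [y 0, quasi_diff r y 0] :: complex ^ 2"
  let ?z = "vector [y N, quasi_diff r y N] :: complex ^ 2"
  note mem_bc_class[of A B]
  moreover have "(T ** A) *v ?x + (T ** B) *v ?z = T *v (A *v ?x + B *v ?z)" for T :: cmat2
    by (simp add: matrix_vector_mul_assoc matrix_vector_right_distrib)
  ultimately have "satisfies_bc N (r, q, w) (bc_class A B) y \<longleftrightarrow> A *v ?x + B *v ?z = 0"
    unfolding satisfies_bc_def bc_class_def by (auto simp: matrix_vector_mult_0_right)
  then show ?thesis by (simp add: matrix_vector_mult_eq_bc_holds)
qed

lemma conj_transpose_mult: "conj_transpose (A ** B) = conj_transpose B ** conj_transpose A"
  by (simp add: conj_transpose_def vec_eq_iff transpose_def map_matrix_def matrix_matrix_mult_def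
      sum_2 mult.commute)

text \<open>Membership in \<open>bc_space\<close> speaks of some representative; passing to the
  given one multiplies both sides by \<open>T\<close> and by its conjugate transpose.\<close>

lemma bc_class_self_adjoint:
  assumes "bc_class A B \<in> bc_space"
  shows "A ** J2 ** conj_transpose A = B ** J2 ** conj_transpose B"
proof -
  obtain A' B' where AB: "bc_class A B = bc_class A' B'"
    and eq: "A' ** J2 ** conj_transpose A' = B' ** J2 ** conj_transpose B'"
    using assms by (auto simp: bc_space_def self_adjoint_pair_def)
  note mem_bc_class[of A B]
  then obtain T :: cmat2 where T: "A = T ** A'" "B = T ** B'"
    unfolding AB unfolding bc_class_def by auto
  have "A ** J2 ** conj_transpose A = T ** (A' ** J2 ** conj_transpose A') ** conj_transpose T"
    by (simp add: T conj_transpose_mult matrix_mul_assoc)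
  also have "\<dots> = B ** J2 ** conj_transpose B"
    unfolding eq by (simp add: T conj_transpose_mult matrix_mul_assoc)
  finally show ?thesis .
qed

lemma self_adjoint_entries:
  assumes "A ** J2 ** conj_transpose A = B ** J2 ** conj_transpose B"
  shows "A $ i $ 1 * cnj (A $ j $ 2) - A $ i $ 2 * cnj (A $ j $ 1)
    = B $ i $ 1 * cnj (B $ j $ 2) - B $ i $ 2 * cnj (B $ j $ 1)"
proof -
  have entry: "(M ** J2 ** conj_transpose M) $ i $ j
      = M $ i $ 1 * cnj (M $ j $ 2) - M $ i $ 2 * cnj (M $ j $ 1)" for M
    by (simp add: matrix_matrix_mult_def sum_2 J2_def conj_transpose_def transpose_def
        map_matrix_def vector_2)
  show ?thesis unfolding entry[symmetric] assms ..
qed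

text \<open>Up to sign, the determinant of the boundary condition as a linear system in
  \<open>u0\<close> and \<open>uN\<close> once \<open>y0\<close> is replaced by
  \<open>y1 - \<rho> u0\<close>.\<close>

definition bc_det :: "cmat2 \<Rightarrow> cmat2 \<Rightarrow> real \<Rightarrow> complex" where
  "bc_det A B \<rho> = mu2 A B + of_real \<rho> * mu1 A B"

text \<open>
  The values of \<open>f\<^sub>0 \<Delta> y\<^sub>0\<close> and \<open>f\<^sub>N \<Delta> y\<^sub>N\<close> forced by the boundary condition, by Cramer's rule after the
  substitution \<open>y\<^sub>0 = y\<^sub>1 - \<rho> f\<^sub>0 \<Delta> y\<^sub>0\<close> with \<open>\<rho> = 1/f\<^sub>0\<close>.
\<close>

definition left_flux :: "cmat2 \<Rightarrow> cmat2 \<Rightarrow> real \<Rightarrow> complex \<Rightarrow> complex \<Rightarrow> complex" where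
  "left_flux A B \<rho> y1 yN =
     (mu1 A B * y1 + (B $ 1 $ 1 * B $ 2 $ 2 - B $ 2 $ 1 * B $ 1 $ 2) * yN) / bc_det A B \<rho>"

definition right_flux :: "cmat2 \<Rightarrow> cmat2 \<Rightarrow> real \<Rightarrow> complex \<Rightarrow> complex \<Rightarrow> complex" where
  "right_flux A B \<rho> y1 yN =
     ((A $ 1 $ 2 * A $ 2 $ 1 - A $ 2 $ 2 * A $ 1 $ 1) * y1
      + ((A $ 1 $ 2 - of_real \<rho> * A $ 1 $ 1) * B $ 2 $ 1
         - (A $ 2 $ 2 - of_real \<rho> * A $ 2 $ 1) * B $ 1 $ 1) * yN) / bc_det A B \<rho>"

lemma left_flux_coeff: "left_flux A B \<rho> y1 yN = left_flux A B \<rho> 1 0 * y1 + left_flux A B \<rho> 0 1 * yN"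
  by (simp add: left_flux_def add_divide_distrib)

lemma right_flux_coeff: "right_flux A B \<rho> y1 yN = right_flux A B \<rho> 1 0 * y1 + right_flux A B \<rho> 0 1 * yN"
  by (simp add: right_flux_def add_divide_distrib)

lemma bc_holds_iff_flux:
  assumes "bc_det A B \<rho> \<noteq> 0"
  shows "bc_holds A B (y1 - of_real \<rho> * u0) u0 yN uN \<longleftrightarrow>
    u0 = left_flux A B \<rho> y1 yN \<and> uN = right_flux A B \<rho> y1 yN"
proof -
  define a11 a12 a21 a22 b11 b12 b21 b22
    where ab: "a11 = A $ 1 $ 1" "a12 = A $ 1 $ 2" "a21 = A $ 2 $ 1" "a22 = A $ 2 $ 2"
      "b11 = B $ 1 $ 1" "b12 = B $ 1 $ 2" "b21 = B $ 2 $ 1" "b22 = B $ 2 $ 2"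
  \<comment> \<open>The coefficients of \<open>u0\<close> after \<open>y0\<close> has been
    eliminated.\<close>
  define p1 p2 where p: "p1 = a12 - of_real \<rho> * a11" "p2 = a22 - of_real \<rho> * a21"
  define d where "d = p2 * b12 - p1 * b22"
  have d: "bc_det A B \<rho> = d" "d \<noteq> 0"
    using assms by (simp_all add: bc_det_def mu1_def mu2_def d_def p ab algebra_simps)
  define k1 k2 where k: "k1 = a11 * y1 + b11 * yN" "k2 = a21 * y1 + b21 * yN"
  have 1: "bc_holds A B (y1 - of_real \<rho> * u0) u0 yN uN \<longleftrightarrow>
      k1 + p1 * u0 + b12 * uN = 0 \<and> k2 + p2 * u0 + b22 * uN = 0"
    unfolding bc_holds_def forall_2 k p ab by (simp add: algebra_simps)
  have 2: "left_flux A B \<rho> y1 yN = (k1 * b22 - k2 * b12) / d"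
    by (simp add: left_flux_def d mu1_def k ab algebra_simps)
  have 3: "right_flux A B \<rho> y1 yN = (p1 * k2 - p2 * k1) / d"
    by (simp add: right_flux_def d k p ab algebra_simps)
  show ?thesis
    unfolding 1 2 3
  proof safe
    assume e: "k1 + p1 * u0 + b12 * uN = 0" "k2 + p2 * u0 + b22 * uN = 0"
    have "d * u0 = k1 * b22 - k2 * b12" "d * uN = p1 * k2 - p2 * k1"
      using e unfolding d_def by algebra+
    then show "u0 = (k1 * b22 - k2 * b12) / d" "uN = (p1 * k2 - p2 * k1) / d"
      using d by (simp_all add: field_simps)
  qed (use d(2) in \<open>simp_all add: divide_simps, simp_all add: d_def algebra_simps\<close>)
qed

text \<open>
  The solutions of the boundary condition form a Lagrangian subspace. Self-adjointness means that
  \<open>cnj v\<^sub>0 = c\<^sup>* a\<^sub>1\<close>, \<open>cnj z\<^sub>0 = - c\<^sup>* a\<^sub>2\<close>, \<open>cnj v\<^sub>N = - c\<^sup>* b\<^sub>1\<close>, \<open>cnj z\<^sub>N = c\<^sup>* b\<^sub>2\<close> is a solution for every \<open>c\<close>,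
  where \<open>a\<^sub>j\<close> and \<open>b\<^sub>j\<close> are the columns of \<open>A\<close> and \<open>B\<close>, and every solution has this form.
\<close>

lemma bc_holds_lagrangian:
  assumes sa: "A ** J2 ** conj_transpose A = B ** J2 ** conj_transpose B"
    and det: "bc_det A B \<rho> \<noteq> 0"
    and y: "bc_holds A B y0 u0 yN uN" and z: "bc_holds A B z0 v0 zN vN"
  shows "y0 * cnj v0 - u0 * cnj z0 = yN * cnj vN - uN * cnj zN"
proof -
  define a11 a12 a21 a22 b11 b12 b21 b22
    where ab: "a11 = A $ 1 $ 1" "a12 = A $ 1 $ 2" "a21 = A $ 2 $ 1" "a22 = A $ 2 $ 2"
      "b11 = B $ 1 $ 1" "b12 = B $ 1 $ 2" "b21 = B $ 2 $ 1" "b22 = B $ 2 $ 2"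
  define p1 p2 where p: "p1 = of_real \<rho> * a11 - a12" "p2 = of_real \<rho> * a21 - a22"
  define d where "d = cnj p1 * cnj b22 - cnj p2 * cnj b12"
  have "d = cnj (bc_det A B \<rho>)"
    by (simp add: bc_det_def mu1_def mu2_def d_def p ab algebra_simps)
  then have d: "d \<noteq> 0" using det by simp
  define z1 where "z1 = z0 + of_real \<rho> * v0"
  \<comment> \<open>Cramer's rule for the parameter whose solution has the given values of
    \<open>z0 + \<rho> v0\<close> and \<open>zN\<close>.\<close>
  define c1 c2 where c: "c1 = (z1 * cnj b22 - zN * cnj p2) / d" "c2 = (zN * cnj p1 - z1 * cnj b12) / d"
  have dc: "d * c1 = z1 * cnj b22 - zN * cnj p2" "d * c2 = zN * cnj p1 - z1 * cnj b12"
    using d by (simp_all add: c)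
  have "d * (cnj p1 * c1 + cnj p2 * c2) = d * z1" "d * (cnj b12 * c1 + cnj b22 * c2) = d * zN"
    using dc unfolding d_def by algebra+
  then have z1: "z1 = cnj p1 * c1 + cnj p2 * c2" and zN: "zN = cnj b12 * c1 + cnj b22 * c2"
    using d by simp_all
  define v0' where "v0' = cnj a11 * c1 + cnj a21 * c2"
  define vN' where "vN' = - (cnj b11 * c1 + cnj b21 * c2)"
  have z0': "z1 - of_real \<rho> * v0' = - (cnj a12 * c1 + cnj a22 * c2)"
    by (simp add: z1 v0'_def p algebra_simps)
  have "bc_holds A B (z1 - of_real \<rho> * v0') v0' zN vN'"
    unfolding bc_holds_def
  proof
    fix i
    have "A $ i $ 1 * (z1 - of_real \<rho> * v0') + A $ i $ 2 * v0' + B $ i $ 1 * zN + B $ i $ 2 * vN'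
      = ((B $ i $ 1 * cnj b12 - B $ i $ 2 * cnj b11) - (A $ i $ 1 * cnj a12 - A $ i $ 2 * cnj a11)) * c1
      + ((B $ i $ 1 * cnj b22 - B $ i $ 2 * cnj b21) - (A $ i $ 1 * cnj a22 - A $ i $ 2 * cnj a21)) * c2"
      unfolding z0' by (simp add: v0'_def zN vN'_def algebra_simps)
    also have "\<dots> = 0"
      using self_adjoint_entries[OF sa, of i 1] self_adjoint_entries[OF sa, of i 2]
      by (simp add: ab)
    finally show "A $ i $ 1 * (z1 - of_real \<rho> * v0') + A $ i $ 2 * v0' + B $ i $ 1 * zN
      + B $ i $ 2 * vN' = 0" .
  qed
  moreover have "bc_holds A B (z1 - of_real \<rho> * v0) v0 zN vN"
    using z by (simp add: z1_def)
  \<comment> \<open>Both solutions share \<open>z1\<close> and \<open>zN\<close>, which determine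
    the fluxes.\<close>
  ultimately have v: "v0 = v0'" "vN = vN'"
    unfolding bc_holds_iff_flux[OF det] by simp_all
  have z0: "z0 = - (cnj a12 * c1 + cnj a22 * c2)"
    using z0' by (simp add: v[symmetric] z1_def)
  \<comment> \<open>The difference is a combination of the two boundary equations for
    \<open>y\<close>, with coefficients \<open>cnj c1\<close> and \<open>cnj c2\<close>.\<close>
  have "y0 * cnj v0 - u0 * cnj z0 - (yN * cnj vN - uN * cnj zN)
      = (a11 * y0 + a12 * u0 + b11 * yN + b12 * uN) * cnj c1
      + (a21 * y0 + a22 * u0 + b21 * yN + b22 * uN) * cnj c2"
    by (simp add: v z0 zN v0'_def vN'_def algebra_simps)
  also have "\<dots> = 0"
    using y by (simp add: bc_holds_def forall_2 ab)
  finally show ?thesis by simp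
qed

text \<open>Summation by parts, arranged so that \<open>z\<close> is evaluated only on
  \<open>1..N\<close>.\<close>

lemma sum_backward_diff_mult:
  fixes F z :: "nat \<Rightarrow> 'a::comm_ring"
  assumes "N \<ge> 1"
  shows "(\<Sum>n\<in>{1..N}. (F (n - 1) - F n) * z n)
    = F 0 * z 1 - F N * z N + (\<Sum>n\<in>{1..<N}. F n * (z (Suc n) - z n))"
  using assms
proof (induction N rule: dec_induct)
  case (step N)
  then show ?case by (simp add: sum.atLeastLessThan_Suc algebra_simps)
qed (simp add: algebra_simps)

lemma dim_image_injective:
  assumes add: "\<And>x y. f (x + y) = f x + f y" and scale: "\<And>c x. f (cseq_scale c x) = cseq_scale c (f x)"
    and U: "cseq.subspace U" and inj: "inj_on f U"
  shows "cseq.dim (f ` U) = cseq.dim U"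
proof -
  interpret f: Vector_Spaces.linear cseq_scale cseq_scale f
    unfolding Vector_Spaces.linear_iff using add scale by (auto intro: cseq.vector_space_axioms)
  obtain B where B: "B \<subseteq> U" "cseq.independent B" "U \<subseteq> cseq.span B" "card B = cseq.dim U"
    by (rule cseq.basis_exists)
  have sp: "cseq.span B = U" using B U by (simp add: cseq.span_minimal subset_antisym)
  show ?thesis
  proof (rule cseq.dim_unique)
    show "f ` B \<subseteq> f ` U" using B by blast
    show "f ` U \<subseteq> cseq.span (f ` B)" using sp by (simp add: f.span_image)
    show "cseq.independent (f ` B)" using B sp inj by (intro f.independent_injective_image) auto
    show "card (f ` B) = cseq.dim U" using B inj by (metis card_image inj_on_subset)
  qed
qed

section \<open>Reduction to a Hermitian pencil\<close>

lemma equation_spaceD: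
  assumes "(r, q, w) \<in> equation_space N"
  shows "n \<le> N \<Longrightarrow> r n \<noteq> 0" "n \<in> {1..N} \<Longrightarrow> w n > 0"
  using assms by (simp_all add: equation_space_def)

locale boundary_problem =
  fixes N :: nat and A B :: cmat2
  assumes N_ge_2: "N \<ge> 2"
    and bc_self_adjoint: "A ** J2 ** conj_transpose A = B ** J2 ** conj_transpose B"
    and mu: "(mu1 A B = 0 \<and> mu2 A B \<noteq> 0) \<or> (mu1 A B \<noteq> 0 \<and> mu2 A B = 0)"
begin

text \<open>The quasi-difference in terms of \<open>y 1, ..., y N\<close> alone: at both ends it is
  the value forced by the boundary condition.\<close>

definition flux :: "(nat \<Rightarrow> real) \<Rightarrow> (nat \<Rightarrow> complex) \<Rightarrow> nat \<Rightarrow> complex" where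
  "flux r y n =
     (if n = 0 then left_flux A B (r 0) (y 1) (y N)
      else if n = N then right_flux A B (r 0) (y 1) (y N)
      else (y (Suc n) - y n) / of_real (r n))"

definition sl_op :: "equation \<Rightarrow> (nat \<Rightarrow> complex) \<Rightarrow> nat \<Rightarrow> complex" where
  "sl_op = (\<lambda>(r, q, w) y n. if n \<in> {1..N}
     then (flux r y (n - 1) - flux r y n + of_real (q n) * y n) / of_real (w n) else 0)"

definition boundary_energy :: "real \<Rightarrow> (nat \<Rightarrow> complex) \<Rightarrow> complex" where
  "boundary_energy \<rho> y = left_flux A B \<rho> (y 1) (y N) * cnj (y 1)
     - right_flux A B \<rho> (y 1) (y N) * cnj (y N)"

definition energy :: "(nat \<Rightarrow> real) \<Rightarrow> (nat \<Rightarrow> real) \<Rightarrow> (nat \<Rightarrow> complex) \<Rightarrow> real" where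
  "energy r q y = Re (boundary_energy (r 0) y)
     + (\<Sum>n\<in>{1..<N}. (cmod (y (Suc n) - y n))\<^sup>2 / r n)
     + (\<Sum>n\<in>{1..N}. q n * (cmod (y n))\<^sup>2)"

definition weight :: "(nat \<Rightarrow> real) \<Rightarrow> (nat \<Rightarrow> complex) \<Rightarrow> real" where
  "weight w y = (\<Sum>n\<in>{1..N}. w n * (cmod (y n))\<^sup>2)"

definition support :: "(nat \<Rightarrow> complex) set" where
  "support = {y. \<forall>n. n \<notin> {1..N} \<longrightarrow> y n = 0}"

text \<open>Recovers \<open>y 0\<close> and \<open>y (N + 1)\<close> from the fluxes. Only here does
  \<open>r N\<close> enter, whence the eigenvalues are independent of it.\<close>

definition extend :: "(nat \<Rightarrow> real) \<Rightarrow> (nat \<Rightarrow> complex) \<Rightarrow> nat \<Rightarrow> complex" where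
  "extend r y n =
     (if n = 0 then y 1 - of_real (r 0) * flux r y 0
      else if n = N + 1 then y N + of_real (r N) * flux r y N
      else if n \<le> N then y n else 0)"

text \<open>One summand vanishes and the other does not, so the boundary condition can be solved for
  the fluxes at every \<open>\<rho> \<noteq> 0\<close>.\<close>

lemma bc_det_nonzero: "\<rho> \<noteq> 0 \<Longrightarrow> bc_det A B \<rho> \<noteq> 0"
  using mu by (auto simp: bc_det_def)

lemma flux_add: "flux r (x + y) n = flux r x n + flux r y n"
  by (simp add: flux_def left_flux_def right_flux_def add_divide_distrib diff_divide_distrib algebra_simps)

lemma flux_scale: "flux r (cseq_scale c x) n = c * flux r x n"
  by (simp add: flux_def left_flux_def right_flux_def cseq_scale_def algebra_simps)

lemma sl_op_prod:
  assumes "(r, q, w) \<in> equation_space N"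
  shows "(\<Sum>n\<in>{1..N}. of_real (w n) * sl_op (r, q, w) x n * cnj (y n))
    = flux r x 0 * cnj (y 1) - flux r x N * cnj (y N)
      + (\<Sum>n\<in>{1..<N}. (x (Suc n) - x n) * cnj (y (Suc n) - y n) / of_real (r n))
      + (\<Sum>n\<in>{1..N}. of_real (q n) * x n * cnj (y n))"
proof -
  have w: "w n \<noteq> 0" if "n \<in> {1..N}" for n
    using equation_spaceD(2)[OF assms that] by simp
  have "(\<Sum>n\<in>{1..N}. of_real (w n) * sl_op (r, q, w) x n * cnj (y n))
    = (\<Sum>n\<in>{1..N}. (flux r x (n - 1) - flux r x n) * cnj (y n) + of_real (q n) * x n * cnj (y n))"
  proof (rule sum.cong)
    fix n assume n: "n \<in> {1..N}"
    then have "of_real (w n) * sl_op (r, q, w) x n = flux r x (n - 1) - flux r x n + of_real (q n) * x n"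
      using w[OF n] by (simp add: sl_op_def)
    then show "of_real (w n) * sl_op (r, q, w) x n * cnj (y n)
      = (flux r x (n - 1) - flux r x n) * cnj (y n) + of_real (q n) * x n * cnj (y n)"
      by (simp only: ring_distribs)
  qed simp
  also have "\<dots> = (\<Sum>n\<in>{1..N}. (flux r x (n - 1) - flux r x n) * cnj (y n))
      + (\<Sum>n\<in>{1..N}. of_real (q n) * x n * cnj (y n))"
    by (rule sum.distrib)
  also have "(\<Sum>n\<in>{1..N}. (flux r x (n - 1) - flux r x n) * cnj (y n))
    = flux r x 0 * cnj (y 1) - flux r x N * cnj (y N)
      + (\<Sum>n\<in>{1..<N}. flux r x n * (cnj (y (Suc n)) - cnj (y n)))"
    using N_ge_2 by (intro sum_backward_diff_mult) simp
  also have "(\<Sum>n\<in>{1..<N}. flux r x n * (cnj (y (Suc n)) - cnj (y n)))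
    = (\<Sum>n\<in>{1..<N}. (x (Suc n) - x n) * cnj (y (Suc n) - y n) / of_real (r n))"
    by (rule sum.cong) (auto simp: flux_def)
  finally show ?thesis .
qed

text \<open>The parameters may differ because they enter only when \<open>y 0\<close> is expressed
  by \<open>y 1\<close>; the boundary condition is the same. Equal parameters give self-adjointness,
  different ones monotonicity in \<open>r 0\<close>.\<close>

lemma boundary_lagrangian:
  assumes "\<rho> \<noteq> 0" "\<sigma> \<noteq> 0"
  shows "(y1 - of_real \<rho> * left_flux A B \<rho> y1 yN) * cnj (left_flux A B \<sigma> z1 zN)
      - left_flux A B \<rho> y1 yN * cnj (z1 - of_real \<sigma> * left_flux A B \<sigma> z1 zN)
    = yN * cnj (right_flux A B \<sigma> z1 zN) - right_flux A B \<rho> y1 yN * cnj zN"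
  using bc_holds_lagrangian[OF bc_self_adjoint bc_det_nonzero[OF assms(1)]]
    bc_holds_iff_flux[OF bc_det_nonzero[OF assms(1)]]
    bc_holds_iff_flux[OF bc_det_nonzero[OF assms(2)]] by blast

lemma self_adjoint_operator_sl_op:
  assumes \<omega>: "(r, q, w) \<in> equation_space N"
  shows "self_adjoint_operator (sl_op (r, q, w)) {1..N} w"
proof
  show "sl_op (r, q, w) (x + y) = sl_op (r, q, w) x + sl_op (r, q, w) y" for x y
    by (rule ext) (simp add: sl_op_def flux_add add_divide_distrib diff_divide_distrib algebra_simps)
  show "sl_op (r, q, w) (cseq_scale c x) = cseq_scale c (sl_op (r, q, w) x)" for c x
    by (rule ext) (simp add: sl_op_def flux_scale cseq_scale_apply algebra_simps)
  show "finite {1..N}" by simp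
  show "0 < w n" if "n \<in> {1..N}" for n using equation_spaceD(2)[OF \<omega> that] .
  show "sl_op (r, q, w) x n = 0" if "n \<notin> {1..N}" for x n using that by (auto simp: sl_op_def)
  fix x y :: "nat \<Rightarrow> complex"
  have r0: "r 0 \<noteq> 0" using equation_spaceD(1)[OF \<omega>] by simp
  \<comment> \<open>With equal parameters the terms containing \<open>r 0\<close> cancel, which
    leaves Hermitian symmetry of the boundary term.\<close>
  have bdry: "flux r x 0 * cnj (y 1) - flux r x N * cnj (y N)
      = cnj (flux r y 0 * cnj (x 1) - flux r y N * cnj (x N))"
    using boundary_lagrangian[OF r0 r0, of "x 1" "x N" "y 1" "y N"] N_ge_2
    by (simp add: flux_def algebra_simps)
  have "(\<Sum>n\<in>{1..N}. of_real (w n) * sl_op (r, q, w) x n * cnj (y n))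
      = cnj (\<Sum>n\<in>{1..N}. of_real (w n) * sl_op (r, q, w) y n * cnj (x n))"
    unfolding sl_op_prod[OF \<omega>] bdry by (simp add: mult_ac)
  also have "\<dots> = (\<Sum>n\<in>{1..N}. of_real (w n) * x n * cnj (sl_op (r, q, w) y n))"
    by (simp add: mult_ac)
  finally show "(\<Sum>n\<in>{1..N}. of_real (w n) * sl_op (r, q, w) x n * cnj (y n))
    = (\<Sum>n\<in>{1..N}. of_real (w n) * x n * cnj (sl_op (r, q, w) y n))" .
qed

lemma energy_eq:
  assumes "(r, q, w) \<in> equation_space N"
  shows "Re (\<Sum>n\<in>{1..N}. of_real (w n) * sl_op (r, q, w) y n * cnj (y n)) = energy r q y"
proof -
  have 1: "(\<Sum>n\<in>{1..<N}. (y (Suc n) - y n) * cnj (y (Suc n) - y n) / of_real (r n))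
    = of_real (\<Sum>n\<in>{1..<N}. (cmod (y (Suc n) - y n))\<^sup>2 / r n)"
    unfolding of_real_sum of_real_divide complex_norm_square ..
  have 2: "(\<Sum>n\<in>{1..N}. of_real (q n) * y n * cnj (y n))
    = of_real (\<Sum>n\<in>{1..N}. q n * (cmod (y n))\<^sup>2)"
    unfolding of_real_sum of_real_mult complex_norm_square by (simp add: mult.assoc)
  show ?thesis
    unfolding sl_op_prod[OF assms] 1 2 energy_def boundary_energy_def
    using N_ge_2 by (simp add: flux_def)
qed

section \<open>Correspondence between the eigenspaces\<close>

lemma extend_quasi_diff:
  assumes "(r, q, w) \<in> equation_space N" "n \<le> N"
  shows "quasi_diff r (extend r y) n = flux r y n"
proof -
  have "r n \<noteq> 0" using equation_spaceD(1)[OF assms] .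
  then show ?thesis
    using assms N_ge_2 by (auto simp: quasi_diff_def fwd_diff_def extend_def flux_def)
qed

text \<open>Phrased for two matching sequences, so that it applies both to the restriction of a
  solution and to the extension of an eigenvector.\<close>

lemma solves_equation_iff_sl_op:
  assumes \<omega>: "(r, q, w) \<in> equation_space N" and "y \<in> support"
    and x: "\<And>n. n \<in> {1..N} \<Longrightarrow> x n = y n" "\<And>n. n \<le> N \<Longrightarrow> quasi_diff r x n = flux r y n"
  shows "solves_equation N (r, q, w) z x \<longleftrightarrow> sl_op (r, q, w) y = cseq_scale z y"
proof -
  have 1: "sl_op (r, q, w) y n = z * y n \<longleftrightarrow>
      - bwd_diff (quasi_diff r x) n + of_real (q n) * x n = z * of_real (w n) * x n"
    if n: "n \<in> {1..N}" for n
  proof -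
    have "w n \<noteq> 0" using equation_spaceD(2)[OF \<omega> n] by simp
    moreover have "n - 1 \<le> N" using n by auto
    ultimately show ?thesis
      using n by (simp add: x bwd_diff_def sl_op_def field_simps)
  qed
  have "sl_op (r, q, w) y n = z * y n" if "n \<notin> {1..N}" for n
    using that assms(2) by (auto simp: support_def sl_op_def)
  then have "sl_op (r, q, w) y = cseq_scale z y \<longleftrightarrow> (\<forall>n\<in>{1..N}. sl_op (r, q, w) y n = z * y n)"
    unfolding fun_eq_iff cseq_scale_apply by blast
  then show ?thesis
    unfolding solves_equation_def by (simp only: 1 split_conv cong: ball_cong)
qed

text \<open>Restriction to \<open>1..N\<close> inverts \<open>extend r\<close>: the boundary
  condition identifies the quasi-differences at both ends with the fluxes, and these determine
  \<open>y 0\<close> and \<open>y (N + 1)\<close>.\<close>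

lemma eigenspace_eq:
  assumes \<omega>: "(r, q, w) \<in> equation_space N"
  shows "eigenspace N (r, q, w) (bc_class A B) z
    = extend r ` {y\<in>support. sl_op (r, q, w) y = cseq_scale z y}"
proof (rule set_eqI, rule iffI)
  have r: "r n \<noteq> 0" if "n \<le> N" for n using equation_spaceD(1)[OF \<omega> that] .
  fix x
  {
    assume x: "x \<in> eigenspace N (r, q, w) (bc_class A B) z"
    define y where "y = (\<lambda>n. if n \<in> {1..N} then x n else 0)"
    have y: "y \<in> support" by (simp add: y_def support_def)
    have y1N: "y 1 = x 1" "y N = x N" using N_ge_2 by (auto simp: y_def)
    have x0: "x 0 = x 1 - of_real (r 0) * quasi_diff r x 0"
      using r[of 0] by (simp add: quasi_diff_def fwd_diff_def)
    have xN: "x (N + 1) = x N + of_real (r N) * quasi_diff r x N"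
      using r[of N] by (simp add: quasi_diff_def fwd_diff_def)
    have "bc_holds A B (x 1 - of_real (r 0) * quasi_diff r x 0) (quasi_diff r x 0) (x N) (quasi_diff r x N)"
      unfolding x0[symmetric] using x by (simp add: eigenspace_def satisfies_bc_class_iff)
    then have bd: "quasi_diff r x 0 = flux r y 0" "quasi_diff r x N = flux r y N"
      unfolding bc_holds_iff_flux[OF bc_det_nonzero[OF r[of 0, simplified]]]
      using N_ge_2 y1N by (auto simp: flux_def)
    have "quasi_diff r x n = flux r y n" if "n \<le> N" for n
      using that bd by (cases "n = 0 \<or> n = N") (auto simp: quasi_diff_def fwd_diff_def flux_def y_def)
    then have "sl_op (r, q, w) y = cseq_scale z y"
      using x by (subst solves_equation_iff_sl_op[OF \<omega> y, symmetric, where x = x])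
        (auto simp: y_def eigenspace_def)
    moreover have "x = extend r y"
    proof
      fix n
      consider "n = 0" | "n = N + 1" | "n \<in> {1..N}" | "n > N + 1" by fastforce
      then show "x n = extend r y n"
      proof cases
        case 1 then show ?thesis using x0 bd y1N by (simp add: extend_def)
      next
        case 2 then show ?thesis using xN bd y1N by (simp add: extend_def)
      next
        case 3 then show ?thesis by (simp add: extend_def y_def)
      next
        case 4 then show ?thesis using x by (simp add: extend_def eigenspace_def)
      qed
    qed
    ultimately show "x \<in> extend r ` {y\<in>support. sl_op (r, q, w) y = cseq_scale z y}"
      using y by blast
  next
    assume "x \<in> extend r ` {y\<in>support. sl_op (r, q, w) y = cseq_scale z y}"
    then obtain y where y: "y \<in> support" "sl_op (r, q, w) y = cseq_scale z y" and x: "x = extend r y"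
      by blast
    note qd = extend_quasi_diff[OF \<omega>, of _ y, folded x]
    have xy: "x n = y n" if "n \<in> {1..N}" for n using that by (auto simp: x extend_def)
    have "solves_equation N (r, q, w) z x"
      using y xy qd by (subst solves_equation_iff_sl_op[OF \<omega> y(1)]) auto
    moreover have "satisfies_bc N (r, q, w) (bc_class A B) x"
    proof -
      have "x 0 = y 1 - of_real (r 0) * flux r y 0" by (simp add: x extend_def)
      moreover have "x N = y N" using xy N_ge_2 by simp
      ultimately show ?thesis
        unfolding satisfies_bc_class_iff qd[OF order_refl] qd[OF le0]
        using N_ge_2 by (simp add: bc_holds_iff_flux bc_det_nonzero r flux_def)
    qed
    ultimately show "x \<in> eigenspace N (r, q, w) (bc_class A B) z"
      by (auto simp: eigenspace_def x extend_def)
  }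
qed

lemma dim_eigenspace_eq_dim_sl_op:
  assumes "(r, q, w) \<in> equation_space N"
  shows "cseq.dim (eigenspace N (r, q, w) (bc_class A B) z)
    = cseq.dim {y\<in>support. sl_op (r, q, w) y = cseq_scale z y}"
  unfolding eigenspace_eq[OF assms]
proof (rule dim_image_injective)
  interpret self_adjoint_operator "sl_op (r, q, w)" "{1..N}" w
    by (rule self_adjoint_operator_sl_op[OF assms])
  show "extend r (x + y) = extend r x + extend r y" for x y
    by (rule ext) (simp add: extend_def flux_add algebra_simps)
  show "extend r (cseq_scale c x) = cseq_scale c (extend r x)" for c x
    by (rule ext) (simp add: extend_def flux_scale cseq_scale_apply algebra_simps)
  show "cseq.subspace {y\<in>support. sl_op (r, q, w) y = cseq_scale z y}"
    by (rule cseq.subspaceI)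
      (auto simp: support_def zero add scale cseq.scale_right_distrib cseq_scale_apply mult.commute)
  show "inj_on (extend r) {y\<in>support. sl_op (r, q, w) y = cseq_scale z y}"
  proof (rule inj_onI, rule ext)
    fix x y n
    assume xy: "x \<in> {y\<in>support. sl_op (r, q, w) y = cseq_scale z y}"
      "y \<in> {y\<in>support. sl_op (r, q, w) y = cseq_scale z y}" "extend r x = extend r y"
    show "x n = y n"
    proof (cases "n \<in> {1..N}")
      case True
      then have "x n = extend r x n" "y n = extend r y n" by (auto simp: extend_def)
      then show ?thesis using xy by simp
    next
      case False
      then show ?thesis using xy by (auto simp: support_def)
    qed
  qed
qed

lemma extend_eq_0_iff:
  assumes "y \<in> support"
  shows "extend r y = 0 \<longleftrightarrow> y = 0"
proof
  assume 0: "extend r y = 0"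
  show "y = 0"
  proof
    fix n
    show "y n = 0 n"
      using assms fun_cong[OF 0, of n]
      by (cases "n \<in> {1..N}") (auto simp: extend_def support_def)
  qed
next
  assume y: "y = 0"
  have "flux r 0 n = 0" for n using flux_scale[of r 0 0 n] by simp
  then show "extend r y = 0" unfolding y by (intro ext) (simp add: extend_def)
qed

text \<open>Interface to the spectral theory: \<open>E\<close> is a complete eigensystem, and the
  counting criterion mentions only the forms \<open>energy\<close> and
  \<open>weight\<close>.\<close>

lemma eigenvalues_via_sl_op:
  assumes \<omega>: "(r, q, w) \<in> equation_space N"
  obtains E :: "(nat \<Rightarrow> complex) set" and eig
  where "finite E" "card E = N"
    and "eigenvalues N (r, q, w) (bc_class A B) = (\<lambda>b. of_real (eig b)) ` E"
    and "eigenvalue_mset N (r, q, w) (bc_class A B) = image_mset (\<lambda>b. of_real (eig b)) (mset_set E)"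
    and "\<And>m c. m \<le> card {b\<in>E. eig b < c} \<longleftrightarrow> (\<exists>v. (\<forall>i. v i \<in> support) \<and>
      (\<forall>a. (\<exists>i<m. a i \<noteq> 0) \<longrightarrow> energy r q (comb {..<m} a v) - c * weight w (comb {..<m} a v) < 0))"
proof -
  interpret self_adjoint_operator "sl_op (r, q, w)" "{1..N}" w
    by (rule self_adjoint_operator_sl_op[OF \<omega>])
  obtain E where E: "complete_eigensystem E" using complete_eigensystem_exists ..
  have V: "V = support" unfolding V_def support_def ..
  have ev: "eigenvalues N (r, q, w) (bc_class A B) = (\<lambda>b. of_real (eig b)) ` E"
    using eigenvalues_eq[OF E] unfolding eigenvalues_def eigenspace_eq[OF \<omega>] V
    by (auto simp: extend_eq_0_iff Bex_def)
  show ?thesis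
  proof (rule that)
    show "finite E" by (rule finite_B[OF E])
    show "card E = N" using card_B[OF E] by simp
    show "eigenvalues N (r, q, w) (bc_class A B) = (\<lambda>b. of_real (eig b)) ` E" by (rule ev)
    show "eigenvalue_mset N (r, q, w) (bc_class A B) = image_mset (\<lambda>b. of_real (eig b)) (mset_set E)"
      unfolding eigenvalue_mset_def image_mset_mset_set_conv_sum[OF finite_B[OF E]] ev
        dim_eigenspace_eq_dim_sl_op[OF \<omega>] dim_eigenspace[OF E, unfolded V] ..
    show "m \<le> card {b\<in>E. eig b < c} \<longleftrightarrow> (\<exists>v. (\<forall>i. v i \<in> support) \<and>
      (\<forall>a. (\<exists>i<m. a i \<noteq> 0) \<longrightarrow> energy r q (comb {..<m} a v) - c * weight w (comb {..<m} a v) < 0))"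
      for m c
      unfolding le_card_eig_less_iff[OF E] negative_family_def V wprod_def mass_def
        energy_eq[OF \<omega>] weight_def ..
  qed
qed

section \<open>Continuity and monotonicity\<close>

definition nth_ev :: "(nat \<Rightarrow> real) \<Rightarrow> (nat \<Rightarrow> real) \<Rightarrow> (nat \<Rightarrow> real) \<Rightarrow> nat \<Rightarrow> real" where
  "nth_ev r q w n = nth_eigenvalue N (r, q, w) (bc_class A B) n"

text \<open>Numbering starts at 0, so \<open>\<lambda>\<^sub>n < c\<close> means that at least
  \<open>Suc n\<close> eigenvalues lie below \<open>c\<close>.\<close>

lemma nth_ev_less_iff:
  assumes \<omega>: "(r, q, w) \<in> equation_space N" and n: "n < N"
  shows "nth_ev r q w n < c \<longleftrightarrow> (\<exists>v. (\<forall>i. v i \<in> support) \<and>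
    (\<forall>a. (\<exists>i<Suc n. a i \<noteq> 0) \<longrightarrow>
      energy r q (comb {..<Suc n} a v) - c * weight w (comb {..<Suc n} a v) < 0))"
proof (rule eigenvalues_via_sl_op[OF \<omega>])
  fix E :: "(nat \<Rightarrow> complex) set" and eig
  assume E: "finite E" "card E = N"
    and ms: "eigenvalue_mset N (r, q, w) (bc_class A B) = image_mset (\<lambda>b. of_real (eig b)) (mset_set E)"
    and iff: "\<And>m c. m \<le> card {b\<in>E. eig b < c} \<longleftrightarrow> (\<exists>v. (\<forall>i. v i \<in> support) \<and>
      (\<forall>a. (\<exists>i<m. a i \<noteq> 0) \<longrightarrow> energy r q (comb {..<m} a v) - c * weight w (comb {..<m} a v) < 0))"
  have "image_mset Re (eigenvalue_mset N (r, q, w) (bc_class A B)) = image_mset eig (mset_set E)"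
    unfolding ms by (simp add: multiset.map_comp comp_def)
  then have "nth_ev r q w n < c \<longleftrightarrow> n < size (filter_mset (\<lambda>x. x < c) (image_mset eig (mset_set E)))"
    unfolding nth_ev_def nth_eigenvalue_def using n E
    by (simp add: nth_sorted_list_of_multiset_less_iff)
  also have "size (filter_mset (\<lambda>x. x < c) (image_mset eig (mset_set E))) = card {b\<in>E. eig b < c}"
    using E by (simp add: filter_mset_image_mset filter_mset_mset_set)
  also have "n < card {b\<in>E. eig b < c} \<longleftrightarrow> Suc n \<le> card {b\<in>E. eig b < c}"
    by (rule Suc_le_eq[symmetric])
  finally show ?thesis unfolding iff .
qed

text \<open>The same family witnesses both inequalities. The levels \<open>c\<close> and
  \<open>c'\<close> may differ, as the continuity estimate requires.\<close>

lemma nth_ev_less_transfer: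
  assumes "(r, q, w) \<in> equation_space N" "(r', q', w') \<in> equation_space N" "n < N"
    and "nth_ev r q w n < c"
    and "\<And>y. y \<in> support \<Longrightarrow> energy r q y - c * weight w y < 0 \<Longrightarrow> energy r' q' y - c' * weight w' y < 0"
  shows "nth_ev r' q' w' n < c'"
proof -
  obtain v where v: "\<And>i. v i \<in> support"
    and neg: "\<And>a. \<exists>i<Suc n. a i \<noteq> 0 \<Longrightarrow>
      energy r q (comb {..<Suc n} a v) - c * weight w (comb {..<Suc n} a v) < 0"
    using assms(4) unfolding nth_ev_less_iff[OF assms(1,3)] by blast
  have "comb {..<Suc n} a v \<in> support" for a
    using v by (auto simp: support_def comb_apply simp del: sum.lessThan_Suc)
  with neg assms(5) have "\<And>a. \<exists>i<Suc n. a i \<noteq> 0 \<Longrightarrow>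
      energy r' q' (comb {..<Suc n} a v) - c' * weight w' (comb {..<Suc n} a v) < 0"
    by blast
  with v show ?thesis
    unfolding nth_ev_less_iff[OF assms(2,3)] by blast
qed

lemma nth_ev_mono_energy:
  assumes "(r, q, w) \<in> equation_space N" "(r', q', w) \<in> equation_space N" "n < N"
    and le: "\<And>y. y \<in> support \<Longrightarrow> energy r' q' y \<le> energy r q y"
  shows "nth_ev r' q' w n \<le> nth_ev r q w n"
proof (rule dense_ge)
  fix c assume "nth_ev r q w n < c"
  then show "nth_ev r' q' w n \<le> c"
    by (intro less_imp_le[OF nth_ev_less_transfer[OF assms(1-3), where c = c]])
      (use le in fastforce)+
qed

text \<open>A larger weight raises \<open>c * weight w y\<close> for positive \<open>c\<close> and
  lowers it for negative \<open>c\<close>, so the comparison reverses at 0.\<close>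

lemma nth_ev_weight:
  assumes \<omega>: "(r, q, w) \<in> equation_space N" "(r, q, w') \<in> equation_space N" and n: "n < N"
    and le: "\<And>n. w n \<le> w' n"
  shows "max (nth_ev r q w' n) 0 \<le> max (nth_ev r q w n) 0"
    and "min (nth_ev r q w n) 0 \<le> min (nth_ev r q w' n) 0"
proof -
  have W: "weight w y \<le> weight w' y" for y
    unfolding weight_def using le by (intro sum_mono mult_right_mono) auto
  show "max (nth_ev r q w' n) 0 \<le> max (nth_ev r q w n) 0"
  proof (rule dense_ge)
    fix c assume c: "max (nth_ev r q w n) 0 < c"
    have "nth_ev r q w' n < c"
    proof (rule nth_ev_less_transfer[OF \<omega> n])
      show "nth_ev r q w n < c" using c by simp
      fix y assume "energy r q y - c * weight w y < 0"
      moreover have "c * weight w y \<le> c * weight w' y" using W c by (intro mult_left_mono) auto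
      ultimately show "energy r q y - c * weight w' y < 0" by linarith
    qed
    then show "max (nth_ev r q w' n) 0 \<le> c" using c by simp
  qed
  show "min (nth_ev r q w n) 0 \<le> min (nth_ev r q w' n) 0"
  proof (cases "nth_ev r q w' n < 0")
    case True
    have "nth_ev r q w n \<le> nth_ev r q w' n"
    \<comment> \<open>Only levels strictly between the eigenvalue and 0 need to be tested, and there
      \<open>c\<close> is negative.\<close>
    proof (rule dense_ge_bounded[OF True])
      fix c assume c: "nth_ev r q w' n < c" "c < 0"
      have "nth_ev r q w n < c"
      proof (rule nth_ev_less_transfer[OF \<omega>(2,1) n c(1)])
        fix y assume "energy r q y - c * weight w' y < 0"
        moreover have "c * weight w' y \<le> c * weight w y" using W c by (intro mult_left_mono_neg) auto
        ultimately show "energy r q y - c * weight w y < 0" by linarith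
      qed
      then show "nth_ev r q w n \<le> c" by simp
    qed
    then show ?thesis by simp
  qed simp
qed

lemma Re_boundary_energy_antimono:
  assumes "\<rho> \<le> \<sigma>" "\<rho> * \<sigma> > 0"
  shows "Re (boundary_energy \<sigma> y) \<le> Re (boundary_energy \<rho> y)"
proof -
  have nz: "\<rho> \<noteq> 0" "\<sigma> \<noteq> 0" using assms by auto
  define u where "u = (\<lambda>\<rho>. left_flux A B \<rho> (y 1) (y N))"
  \<comment> \<open>The second solution enters the Lagrangian identity conjugated; real parts do not
    see this.\<close>
  have "cnj (boundary_energy \<sigma> y) - boundary_energy \<rho> y = of_real (\<rho> - \<sigma>) * (u \<rho> * cnj (u \<sigma>))"
    using boundary_lagrangian[OF nz, of "y 1" "y N" "y 1" "y N"]
    by (simp add: boundary_energy_def u_def algebra_simps)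
  from arg_cong[OF this, of Re]
  have eq: "Re (boundary_energy \<sigma> y) - Re (boundary_energy \<rho> y) = (\<rho> - \<sigma>) * Re (u \<rho> * cnj (u \<sigma>))"
    by simp
  \<comment> \<open>The numerator of the left flux does not depend on the parameter, so the
    denominators decide the sign.\<close>
  define K where "K = mu1 A B * y 1 + (B $ 1 $ 1 * B $ 2 $ 2 - B $ 2 $ 1 * B $ 1 $ 2) * y N"
  have u: "u \<rho> = K / bc_det A B \<rho>" for \<rho>
    by (simp add: u_def left_flux_def K_def)
  have uu: "u \<rho> * cnj (u \<sigma>) = K * cnj K / (bc_det A B \<rho> * cnj (bc_det A B \<sigma>))"
    by (simp add: u)
  \<comment> \<open>The product is \<open>|mu2|^2\<close> or \<open>\<rho> \<sigma> |mu1|^2\<close>;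
    the latter is positive because the parameters have the same sign.\<close>
  obtain t where "t > 0" "bc_det A B \<rho> * cnj (bc_det A B \<sigma>) = of_real t"
  proof (cases "mu1 A B = 0")
    case True
    then show ?thesis using mu
      by (intro that[of "(cmod (mu2 A B))\<^sup>2"]) (auto simp: bc_det_def simp flip: complex_norm_square)
  next
    case False
    then have "bc_det A B \<rho> * cnj (bc_det A B \<sigma>) = of_real (\<rho> * \<sigma> * (cmod (mu1 A B))\<^sup>2)"
      unfolding of_real_mult complex_norm_square using mu by (simp add: bc_det_def)
    from that[OF _ this] show ?thesis using False assms(2) by simp
  qed
  then have "u \<rho> * cnj (u \<sigma>) = of_real ((cmod K)\<^sup>2 / t)"
    unfolding uu of_real_divide complex_norm_square by simp
  then have "Re (u \<rho> * cnj (u \<sigma>)) \<ge> 0" using \<open>t > 0\<close> by simp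
  with assms(1) have "(\<rho> - \<sigma>) * Re (u \<rho> * cnj (u \<sigma>)) \<le> 0" by (intro mult_nonpos_nonneg) auto
  with eq show ?thesis by linarith
qed

text \<open>Bounds the change of the energy relative to the sum of squares of \<open>y\<close>. The
  factor 4 comes from bounding the squared difference of two components by four times that
  sum.\<close>

definition energy_gap :: "equation \<Rightarrow> equation \<Rightarrow> real" where
  "energy_gap = (\<lambda>(r, q, w) (r', q', w').
     cmod (left_flux A B (r 0) 1 0 - left_flux A B (r' 0) 1 0)
     + cmod (left_flux A B (r 0) 0 1 - left_flux A B (r' 0) 0 1)
     + cmod (right_flux A B (r 0) 1 0 - right_flux A B (r' 0) 1 0)
     + cmod (right_flux A B (r 0) 0 1 - right_flux A B (r' 0) 0 1)
     + (\<Sum>n\<in>{1..<N}. 4 * \<bar>1 / r n - 1 / r' n\<bar>) + (\<Sum>n\<in>{1..N}. \<bar>q n - q' n\<bar>))"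

lemma component_mult_le:
  assumes "i \<in> {1..N}" "j \<in> {1..N}"
  shows "cmod (y i) * cmod (y j) \<le> (\<Sum>n\<in>{1..N}. (cmod (y n))\<^sup>2)"
proof -
  have *: "(cmod (y k))\<^sup>2 \<le> (\<Sum>n\<in>{1..N}. (cmod (y n))\<^sup>2)" if "k \<in> {1..N}" for k
    by (rule member_le_sum[OF that]) auto
  have "2 * (cmod (y i) * cmod (y j)) \<le> (cmod (y i))\<^sup>2 + (cmod (y j))\<^sup>2"
    using sum_squares_bound[of "cmod (y i)" "cmod (y j)"] by (simp add: mult.assoc)
  with *[OF assms(1)] *[OF assms(2)] show ?thesis by linarith
qed

lemma energy_diff_le:
  "\<bar>energy r q y - energy r' q' y\<bar>
    \<le> energy_gap (r, q, w) (r', q', w') * (\<Sum>n\<in>{1..N}. (cmod (y n))\<^sup>2)"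
proof -
  define S where "S = (\<Sum>n\<in>{1..N}. (cmod (y n))\<^sup>2)"
  note le = component_mult_le[of _ _ y, folded S_def]
  have N1: "1 \<in> {1..N}" "N \<in> {1..N}" using N_ge_2 by auto
  define d1 d2 d3 d4
    where d: "d1 = left_flux A B (r 0) 1 0 - left_flux A B (r' 0) 1 0"
      "d2 = left_flux A B (r 0) 0 1 - left_flux A B (r' 0) 0 1"
      "d3 = right_flux A B (r 0) 1 0 - right_flux A B (r' 0) 1 0"
      "d4 = right_flux A B (r 0) 0 1 - right_flux A B (r' 0) 0 1"
  have summand: "cmod (z * y i * cnj (y j)) \<le> cmod z * S" if "i \<in> {1..N}" "j \<in> {1..N}" for z i j
    using le[OF that] by (simp add: norm_mult mult.assoc mult_left_mono)
  have "boundary_energy (r 0) y - boundary_energy (r' 0) y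
    = (d1 * y 1 * cnj (y 1) + d2 * y N * cnj (y 1)) - (d3 * y 1 * cnj (y N) + d4 * y N * cnj (y N))"
    unfolding boundary_energy_def left_flux_coeff[of A B _ "y 1"] right_flux_coeff[of A B _ "y 1"] d
    by (simp add: algebra_simps)
  also have "cmod \<dots> \<le> (cmod (d1 * y 1 * cnj (y 1)) + cmod (d2 * y N * cnj (y 1)))
      + (cmod (d3 * y 1 * cnj (y N)) + cmod (d4 * y N * cnj (y N)))"
    by (intro order_trans[OF norm_triangle_ineq4] add_mono norm_triangle_ineq)
  also have "\<dots> \<le> (cmod d1 * S + cmod d2 * S) + (cmod d3 * S + cmod d4 * S)"
    using N1 by (intro add_mono summand)
  finally have b: "\<bar>Re (boundary_energy (r 0) y) - Re (boundary_energy (r' 0) y)\<bar>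
      \<le> (cmod d1 + cmod d2 + cmod d3 + cmod d4) * S"
    using abs_Re_le_cmod[of "boundary_energy (r 0) y - boundary_energy (r' 0) y"]
    by (simp add: algebra_simps)
  have dif: "(cmod (y (Suc n) - y n))\<^sup>2 \<le> 4 * S" if n: "n \<in> {1..<N}" for n
  proof -
    have "(cmod (y (Suc n) - y n))\<^sup>2 \<le> (cmod (y (Suc n)) + cmod (y n))\<^sup>2"
      by (intro power_mono norm_triangle_ineq4) simp
    also have "\<dots> = cmod (y (Suc n)) * cmod (y (Suc n)) + 2 * (cmod (y (Suc n)) * cmod (y n))
        + cmod (y n) * cmod (y n)"
      by (simp add: power2_eq_square algebra_simps)
    also have "\<dots> \<le> S + 2 * S + S"
      using n by (intro add_mono mult_left_mono le) auto
    finally show ?thesis by simp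
  qed
  have "\<bar>(\<Sum>n\<in>{1..<N}. (cmod (y (Suc n) - y n))\<^sup>2 / r n) - (\<Sum>n\<in>{1..<N}. (cmod (y (Suc n) - y n))\<^sup>2 / r' n)\<bar>
    \<le> (\<Sum>n\<in>{1..<N}. \<bar>(cmod (y (Suc n) - y n))\<^sup>2 / r n - (cmod (y (Suc n) - y n))\<^sup>2 / r' n\<bar>)"
    unfolding sum_subtractf[symmetric] by (rule sum_abs)
  also have "\<dots> = (\<Sum>n\<in>{1..<N}. \<bar>1 / r n - 1 / r' n\<bar> * (cmod (y (Suc n) - y n))\<^sup>2)"
  proof (rule sum.cong)
    fix n
    have "(cmod (y (Suc n) - y n))\<^sup>2 / r n - (cmod (y (Suc n) - y n))\<^sup>2 / r' n
      = (1 / r n - 1 / r' n) * (cmod (y (Suc n) - y n))\<^sup>2" by (simp add: left_diff_distrib)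
    then show "\<bar>(cmod (y (Suc n) - y n))\<^sup>2 / r n - (cmod (y (Suc n) - y n))\<^sup>2 / r' n\<bar>
      = \<bar>1 / r n - 1 / r' n\<bar> * (cmod (y (Suc n) - y n))\<^sup>2" by (simp add: abs_mult)
  qed simp
  also have "\<dots> \<le> (\<Sum>n\<in>{1..<N}. 4 * \<bar>1 / r n - 1 / r' n\<bar> * S)"
  proof (rule sum_mono)
    fix n assume "n \<in> {1..<N}"
    from mult_left_mono[OF dif[OF this], of "\<bar>1 / r n - 1 / r' n\<bar>"]
    show "\<bar>1 / r n - 1 / r' n\<bar> * (cmod (y (Suc n) - y n))\<^sup>2 \<le> 4 * \<bar>1 / r n - 1 / r' n\<bar> * S"
      by (simp add: mult_ac)
  qed
  finally have c: "\<bar>(\<Sum>n\<in>{1..<N}. (cmod (y (Suc n) - y n))\<^sup>2 / r n)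
      - (\<Sum>n\<in>{1..<N}. (cmod (y (Suc n) - y n))\<^sup>2 / r' n)\<bar>
    \<le> (\<Sum>n\<in>{1..<N}. 4 * \<bar>1 / r n - 1 / r' n\<bar>) * S"
    by (simp only: sum_distrib_right)
  have "\<bar>(\<Sum>n\<in>{1..N}. q n * (cmod (y n))\<^sup>2) - (\<Sum>n\<in>{1..N}. q' n * (cmod (y n))\<^sup>2)\<bar>
    \<le> (\<Sum>n\<in>{1..N}. \<bar>q n * (cmod (y n))\<^sup>2 - q' n * (cmod (y n))\<^sup>2\<bar>)"
    unfolding sum_subtractf[symmetric] by (rule sum_abs)
  also have "\<dots> = (\<Sum>n\<in>{1..N}. \<bar>q n - q' n\<bar> * (cmod (y n) * cmod (y n)))"
    by (simp add: abs_mult power2_eq_square flip: left_diff_distrib)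
  also have "\<dots> \<le> (\<Sum>n\<in>{1..N}. \<bar>q n - q' n\<bar> * S)"
    by (intro sum_mono mult_left_mono le) auto
  finally have e: "\<bar>(\<Sum>n\<in>{1..N}. q n * (cmod (y n))\<^sup>2) - (\<Sum>n\<in>{1..N}. q' n * (cmod (y n))\<^sup>2)\<bar>
    \<le> (\<Sum>n\<in>{1..N}. \<bar>q n - q' n\<bar>) * S"
    by (simp add: sum_distrib_right)
  have "energy_gap (r, q, w) (r', q', w') * S
    = (cmod d1 + cmod d2 + cmod d3 + cmod d4) * S
      + (\<Sum>n\<in>{1..<N}. 4 * \<bar>1 / r n - 1 / r' n\<bar>) * S + (\<Sum>n\<in>{1..N}. \<bar>q n - q' n\<bar>) * S"
    by (simp add: energy_gap_def d ring_distribs)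
  with b c e show ?thesis unfolding energy_def S_def[symmetric] by linarith
qed

lemma weight_diff_le:
  "\<bar>weight w y - weight w' y\<bar> \<le> (\<Sum>n\<in>{1..N}. \<bar>w n - w' n\<bar>) * (\<Sum>n\<in>{1..N}. (cmod (y n))\<^sup>2)"
proof -
  have "\<bar>weight w y - weight w' y\<bar>
    \<le> (\<Sum>n\<in>{1..N}. \<bar>w n * (cmod (y n))\<^sup>2 - w' n * (cmod (y n))\<^sup>2\<bar>)"
    unfolding weight_def sum_subtractf[symmetric] by (rule sum_abs)
  also have "\<dots> = (\<Sum>n\<in>{1..N}. \<bar>w n - w' n\<bar> * (cmod (y n) * cmod (y n)))"
    by (simp add: abs_mult power2_eq_square flip: left_diff_distrib)
  also have "\<dots> \<le> (\<Sum>n\<in>{1..N}. \<bar>w n - w' n\<bar> * (\<Sum>n\<in>{1..N}. (cmod (y n))\<^sup>2))"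
    by (intro sum_mono mult_left_mono component_mult_le) auto
  finally show ?thesis by (simp add: sum_distrib_right)
qed

text \<open>For levels with \<open>|c| \<le> |l| + e\<close> the perturbation changes the shifted
  form by at most \<open>(1 + |l| + e) k = e / 2\<close> times \<open>weight w0 y\<close>. Moving
  the level by \<open>e / 2\<close> absorbs this.\<close>

lemma nth_ev_continuous_estimate:
  assumes \<omega>: "(r, q, w) \<in> equation_space N" and \<omega>0: "(r0, q0, w0) \<in> equation_space N" and n: "n < N"
    and e: "e > 0" and l: "l = nth_ev r0 q0 w0 n" and k: "k = e / (2 * (1 + \<bar>l\<bar> + e))"
    and E: "\<And>y. \<bar>energy r q y - energy r0 q0 y\<bar> \<le> k * weight w0 y"
    and W: "\<And>y. \<bar>weight w y - weight w0 y\<bar> \<le> k * weight w0 y"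
  shows "\<bar>nth_ev r q w n - l\<bar> \<le> e"
proof -
  have "x * (e / (2 * x)) = e / 2" if "x > 0" for x :: real using that by simp
  from this[of "1 + \<bar>l\<bar> + e"] have half: "(1 + \<bar>l\<bar> + e) * k = e / 2"
    unfolding k using e by linarith
  have shift: "\<bar>(energy r q y - c * weight w y) - (energy r0 q0 y - c * weight w0 y)\<bar> \<le> e / 2 * weight w0 y"
    if c: "\<bar>c\<bar> \<le> \<bar>l\<bar> + e" for c y
  proof -
    have kW: "k * weight w0 y \<ge> 0" using E[of y] by linarith
    have "\<bar>(energy r q y - c * weight w y) - (energy r0 q0 y - c * weight w0 y)\<bar>
      = \<bar>(energy r q y - energy r0 q0 y) - c * (weight w y - weight w0 y)\<bar>"
      by (simp add: algebra_simps)
    also have "\<dots> \<le> \<bar>energy r q y - energy r0 q0 y\<bar> + \<bar>c\<bar> * \<bar>weight w y - weight w0 y\<bar>"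
      using abs_triangle_ineq4[of "energy r q y - energy r0 q0 y" "c * (weight w y - weight w0 y)"]
      by (simp add: abs_mult)
    also have "\<dots> \<le> k * weight w0 y + (\<bar>l\<bar> + e) * (k * weight w0 y)"
      using E W c e by (intro add_mono mult_mono) auto
    also have "\<dots> = ((1 + \<bar>l\<bar> + e) * k) * weight w0 y" by (simp add: algebra_simps)
    also note half
    finally show ?thesis .
  qed
  have "nth_ev r q w n < l + e"
  proof (rule nth_ev_less_transfer[OF \<omega>0 \<omega> n, where c = "l + e / 2"])
    show "nth_ev r0 q0 w0 n < l + e / 2" using e l by simp
    fix y assume "energy r0 q0 y - (l + e / 2) * weight w0 y < 0"
    then have "(energy r0 q0 y - (l + e) * weight w0 y) + e / 2 * weight w0 y < 0"
      by (simp add: algebra_simps)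
    moreover have "\<bar>l + e\<bar> \<le> \<bar>l\<bar> + e" using e by linarith
    note shift[OF this, of y]
    ultimately show "energy r q y - (l + e) * weight w y < 0" by linarith
  qed
  moreover have "\<not> nth_ev r q w n < l - e / 2"
  proof
    assume "nth_ev r q w n < l - e / 2"
    then have "nth_ev r0 q0 w0 n < l"
    proof (rule nth_ev_less_transfer[OF \<omega> \<omega>0 n])
      fix y assume less: "energy r q y - (l - e / 2) * weight w y < 0"
      have "\<bar>l - e / 2\<bar> \<le> \<bar>l\<bar> + e" using e by linarith
      note shift[OF this, of y]
      with less have "(energy r0 q0 y - (l - e / 2) * weight w0 y) - e / 2 * weight w0 y < 0" by linarith
      then show "energy r0 q0 y - l * weight w0 y < 0" by (simp add: algebra_simps)
    qed
    then show False using l by simp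
  qed
  ultimately show ?thesis using e by linarith
qed

lemma continuous_on_nth_ev:
  assumes n: "n < N"
  shows "continuous_on (equation_space N) (\<lambda>\<omega>. nth_eigenvalue N \<omega> (bc_class A B) n)"
  unfolding continuous_on_def
proof
  fix \<omega>0 assume \<omega>0: "\<omega>0 \<in> equation_space N"
  obtain r0 q0 w0 where \<omega>0_eq: "\<omega>0 = (r0, q0, w0)" by (cases \<omega>0)
  note \<omega>0' = \<omega>0[unfolded \<omega>0_eq]
  let ?F = "at \<omega>0 within equation_space N"
  define l where "l = nth_ev r0 q0 w0 n"
  \<comment> \<open>Evaluation at a point is continuous in the product topology.\<close>
  have co: "((\<lambda>x. x i) \<longlongrightarrow> a i) (nhds a)" for i :: nat and a :: "nat \<Rightarrow> real"
  proof -
    have "isCont (\<lambda>x. x i) a"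
      by (rule continuous_on_interior[OF continuous_on_product_coordinates]) simp
    then show ?thesis unfolding isCont_def by (rule tendsto_at_iff_tendsto_nhds[THEN iffD1])
  qed
  have "((\<lambda>\<omega>. fst \<omega>) \<longlongrightarrow> r0) ?F" "((\<lambda>\<omega>. fst (snd \<omega>)) \<longlongrightarrow> q0) ?F" "((\<lambda>\<omega>. snd (snd \<omega>)) \<longlongrightarrow> w0) ?F"
    using tendsto_fst[OF tendsto_ident_at[of \<omega>0 "equation_space N"]]
      tendsto_fst[OF tendsto_snd[OF tendsto_ident_at[of \<omega>0 "equation_space N"]]]
      tendsto_snd[OF tendsto_snd[OF tendsto_ident_at[of \<omega>0 "equation_space N"]]]
    by (simp_all add: \<omega>0_eq)
  then have lim: "((\<lambda>\<omega>. fst \<omega> i) \<longlongrightarrow> r0 i) ?F" "((\<lambda>\<omega>. fst (snd \<omega>) i) \<longlongrightarrow> q0 i) ?F"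
    "((\<lambda>\<omega>. snd (snd \<omega>) i) \<longlongrightarrow> w0 i) ?F" for i
    by (auto intro: filterlim_compose[OF co])
  have nz: "r0 i \<noteq> 0" if "i \<le> N" for i using equation_spaceD(1)[OF \<omega>0' that] .
  have det: "bc_det A B (r0 0) \<noteq> 0" using nz by (intro bc_det_nonzero) simp
  have det_lim: "((\<lambda>\<omega>. bc_det A B (fst \<omega> 0)) \<longlongrightarrow> bc_det A B (r0 0)) ?F"
    unfolding bc_det_def by (intro tendsto_intros lim)
  have flux_lim: "((\<lambda>\<omega>. left_flux A B (fst \<omega> 0) a b) \<longlongrightarrow> left_flux A B (r0 0) a b) ?F"
    "((\<lambda>\<omega>. right_flux A B (fst \<omega> 0) a b) \<longlongrightarrow> right_flux A B (r0 0) a b) ?F" for a b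
    unfolding left_flux_def right_flux_def by (intro tendsto_intros lim det det_lim)+
  have "((\<lambda>\<omega>. energy_gap \<omega> \<omega>0) \<longlongrightarrow> energy_gap \<omega>0 \<omega>0) ?F"
    unfolding energy_gap_def case_prod_unfold
    by (intro tendsto_intros flux_lim[unfolded \<omega>0_eq] lim[unfolded \<omega>0_eq])
      (use nz in \<open>auto simp: \<omega>0_eq intro!: tendsto_intros flux_lim[unfolded \<omega>0_eq] lim[unfolded \<omega>0_eq]\<close>)
  then have gap_lim: "((\<lambda>\<omega>. energy_gap \<omega> \<omega>0) \<longlongrightarrow> 0) ?F"
    by (simp add: energy_gap_def case_prod_unfold)
  have "((\<lambda>\<omega>. \<Sum>i\<in>{1..N}. \<bar>snd (snd \<omega>) i - w0 i\<bar>) \<longlongrightarrow> (\<Sum>i\<in>{1..N}. \<bar>w0 i - w0 i\<bar>)) ?F"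
    by (intro tendsto_intros lim)
  then have w_lim: "((\<lambda>\<omega>. \<Sum>i\<in>{1..N}. \<bar>snd (snd \<omega>) i - w0 i\<bar>) \<longlongrightarrow> 0) ?F"
    by simp
  \<comment> \<open>The smallest weight at \<open>\<omega>0\<close> turns bounds by the sum of
    squares into bounds by \<open>weight w0 y\<close>.\<close>
  define m where "m = Min (w0 ` {1..N})"
  have m: "m > 0" unfolding m_def using equation_spaceD(2)[OF \<omega>0'] N_ge_2
    by (subst Min_gr_iff) auto
  have S: "t * (\<Sum>i\<in>{1..N}. (cmod (y i))\<^sup>2) \<le> k * weight w0 y" if t: "t \<le> k * m" "k \<ge> 0" for t k y
  proof -
    have "t * (\<Sum>i\<in>{1..N}. (cmod (y i))\<^sup>2) \<le> (k * m) * (\<Sum>i\<in>{1..N}. (cmod (y i))\<^sup>2)"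
      by (intro mult_right_mono t sum_nonneg) auto
    also have "\<dots> = k * (\<Sum>i\<in>{1..N}. m * (cmod (y i))\<^sup>2)" by (simp add: sum_distrib_left mult.assoc)
    also have "\<dots> \<le> k * weight w0 y"
      unfolding weight_def m_def using t by (intro mult_left_mono sum_mono mult_right_mono) auto
    finally show ?thesis .
  qed
  show "((\<lambda>\<omega>. nth_eigenvalue N \<omega> (bc_class A B) n) \<longlongrightarrow> nth_eigenvalue N \<omega>0 (bc_class A B) n) ?F"
  proof (rule tendstoI)
    fix e' :: real assume "e' > 0"
    \<comment> \<open>The estimate is not strict, so it is used with half of
      \<open>e'\<close>.\<close>
    define e where "e = e' / 2"
    have e: "e > 0" "e < e'" using \<open>e' > 0\<close> by (simp_all add: e_def)
    define k where "k = e / (2 * (1 + \<bar>l\<bar> + e))"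
    have k: "k > 0" using e by (simp add: k_def add_pos_pos add_nonneg_pos)
    have "\<forall>\<^sub>F \<omega> in ?F. \<omega> \<in> equation_space N"
      by (simp add: eventually_at_filter)
    moreover have "\<forall>\<^sub>F \<omega> in ?F. energy_gap \<omega> \<omega>0 < k * m"
      using k m by (intro order_tendstoD(2)[OF gap_lim]) simp
    moreover have "\<forall>\<^sub>F \<omega> in ?F. (\<Sum>i\<in>{1..N}. \<bar>snd (snd \<omega>) i - w0 i\<bar>) < k * m"
      using k m by (intro order_tendstoD(2)[OF w_lim]) simp
    ultimately show "\<forall>\<^sub>F \<omega> in ?F. dist (nth_eigenvalue N \<omega> (bc_class A B) n)
        (nth_eigenvalue N \<omega>0 (bc_class A B) n) < e'"
    proof eventually_elim
      case (elim \<omega>)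
      obtain r q w where \<omega>: "\<omega> = (r, q, w)" by (cases \<omega>)
      have "\<bar>nth_ev r q w n - l\<bar> \<le> e"
      proof (rule nth_ev_continuous_estimate[OF _ \<omega>0' n e(1) l_def k_def])
        show "(r, q, w) \<in> equation_space N" using elim(1) \<omega> by simp
        fix y
        show "\<bar>energy r q y - energy r0 q0 y\<bar> \<le> k * weight w0 y"
          using elim(2) k unfolding \<omega> \<omega>0_eq
          by (intro order_trans[OF energy_diff_le[of r q y r0 q0 w w0] S]) auto
        show "\<bar>weight w y - weight w0 y\<bar> \<le> k * weight w0 y"
          using elim(3) k unfolding \<omega>
          by (intro order_trans[OF weight_diff_le S]) auto
      qed
      then show ?case using e by (simp add: \<omega> \<omega>0_eq dist_real_def l_def nth_ev_def)
    qed
  qed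
qed

text \<open>For \<open>j = 0\<close> only the boundary term changes. Otherwise one squared
  difference is divided by the new value, and the reciprocal decreases between numbers of the same
  sign.\<close>

lemma energy_antimono_reciprocal:
  assumes st: "s \<le> t" "s * t > 0" and j: "j < N"
  shows "energy (r(j := t)) q y \<le> energy (r(j := s)) q y"
proof (cases "j = 0")
  case True
  then show ?thesis
    unfolding energy_def using Re_boundary_energy_antimono[OF st, of y] by simp
next
  case False
  have "x / t \<le> x / s" if "x \<ge> 0" for x
  proof -
    have "inverse t \<le> inverse s"
      using st by (cases "s > 0") (auto simp: zero_less_mult_iff intro: le_imp_inverse_le le_imp_inverse_le_neg)
    with that show ?thesis by (simp add: divide_inverse mult_left_mono)
  qed
  then have "(\<Sum>n\<in>{1..<N}. (cmod (y (Suc n) - y n))\<^sup>2 / (r(j := t)) n)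
      \<le> (\<Sum>n\<in>{1..<N}. (cmod (y (Suc n) - y n))\<^sup>2 / (r(j := s)) n)"
    by (intro sum_mono) simp
  with False show ?thesis by (simp add: energy_def)
qed

lemma energy_mono_potential:
  assumes "s \<le> t"
  shows "energy r (q(j := s)) y \<le> energy r (q(j := t)) y"
  unfolding energy_def using assms by (intro add_mono sum_mono mult_right_mono) auto

lemma energy_last_reciprocal: "energy (r(N := t)) q y = energy r q y"
  using N_ge_2 by (auto simp: energy_def intro!: sum.cong)

end

text \<open>The coordinate \<open>r j\<close> is continuous and never 0 there, so its image of a
  component is an interval missing 0.\<close>

lemma components_equation_space_sign:
  assumes C: "C \<in> components (equation_space N)" and "(r, q, w) \<in> C" "(r', q', w') \<in> C" "j \<le> N"
  shows "r j * r' j > 0"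
proof -
  have sub: "C \<subseteq> equation_space N" using C by (rule in_components_subset)
  have "continuous_on C (\<lambda>\<omega>. fst \<omega> j)"
    by (rule continuous_on_product_then_coordinatewise) (intro continuous_intros)
  then have conn: "connected ((\<lambda>\<omega>. fst \<omega> j) ` C)"
    using in_components_connected[OF C] by (rule connected_continuous_image)
  have 0: "0 \<notin> (\<lambda>\<omega>. fst \<omega> j) ` C"
    using sub assms(4) equation_spaceD(1) by fastforce
  have mem: "r j \<in> (\<lambda>\<omega>. fst \<omega> j) ` C" "r' j \<in> (\<lambda>\<omega>. fst \<omega> j) ` C"
    using assms(2,3) by (metis fst_conv image_eqI)+
  have "\<not> (a \<le> 0 \<and> 0 \<le> b)" if "a \<in> (\<lambda>\<omega>. fst \<omega> j) ` C" "b \<in> (\<lambda>\<omega>. fst \<omega> j) ` C" for a b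
    using connectedD_interval[OF conn that] 0 by blast
  from this[OF mem] this[OF mem(2,1)] show ?thesis
    by (auto simp: zero_less_mult_iff not_le)
qed

theorem theorem3p2:
  fixes N :: nat and bc :: "(cmat2 \<times> cmat2) set" and A B :: cmat2
  assumes "N \<ge> 2"
    and "bc \<in> bc_space" and "bc = bc_class A B"
    and "(mu1 A B = 0 \<and> mu2 A B \<noteq> 0) \<or> (mu1 A B \<noteq> 0 \<and> mu2 A B = 0)"
  shows
    "(\<forall>\<omega>\<in>equation_space N.
        finite (eigenvalues N \<omega> bc) \<and> eigenvalues N \<omega> bc \<subseteq> \<real> \<and>
        size (eigenvalue_mset N \<omega> bc) = N) \<and>
     (\<forall>n<N. continuous_on (equation_space N) (\<lambda>\<omega>. nth_eigenvalue N \<omega> bc n)) \<and>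
     (\<forall>n<N. \<forall>C\<in>components (equation_space N). \<forall>(r, q, w)\<in>C.
        (\<forall>j\<in>{0..N-1}. antimono_on {t. (r(j := t), q, w) \<in> C}
           (\<lambda>t. nth_eigenvalue N (r(j := t), q, w) bc n)) \<and>
        (\<lambda>t. nth_eigenvalue N (r(N := t), q, w) bc n)
           constant_on {t. (r(N := t), q, w) \<in> C} \<and>
        (\<forall>j\<in>{1..N}. mono_on {t. (r, q(j := t), w) \<in> C}
           (\<lambda>t. nth_eigenvalue N (r, q(j := t), w) bc n)) \<and>
        (\<forall>j\<in>{1..N}. antimono_on {t. (r, q, w(j := t)) \<in> C}
           (\<lambda>t. max (nth_eigenvalue N (r, q, w(j := t)) bc n) 0)) \<and>
        (\<forall>j\<in>{1..N}. mono_on {t. (r, q, w(j := t)) \<in> C}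
           (\<lambda>t. min (nth_eigenvalue N (r, q, w(j := t)) bc n) 0)))"
proof -
  interpret boundary_problem N A B
    using assms bc_class_self_adjoint[of A B] by unfold_locales auto
  have ev: "nth_eigenvalue N (r, q, w) bc n = nth_ev r q w n" for r q w n
    by (simp add: nth_ev_def assms(3))
  have "finite (eigenvalues N \<omega> bc) \<and> eigenvalues N \<omega> bc \<subseteq> \<real> \<and> size (eigenvalue_mset N \<omega> bc) = N"
    if \<omega>: "\<omega> \<in> equation_space N" for \<omega>
  proof -
    obtain r q w where eq: "\<omega> = (r, q, w)" by (cases \<omega>)
    show ?thesis
      unfolding eq assms(3) using \<omega>[unfolded eq] by (rule eigenvalues_via_sl_op) auto
  qed
  moreover have "continuous_on (equation_space N) (\<lambda>\<omega>. nth_eigenvalue N \<omega> bc n)" if "n < N" for n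
    unfolding assms(3) using that by (rule continuous_on_nth_ev)
  moreover have
    "(\<forall>j\<in>{0..N-1}. antimono_on {t. (r(j := t), q, w) \<in> C} (\<lambda>t. nth_ev (r(j := t)) q w n)) \<and>
     (\<lambda>t. nth_ev (r(N := t)) q w n) constant_on {t. (r(N := t), q, w) \<in> C} \<and>
     (\<forall>j\<in>{1..N}. mono_on {t. (r, q(j := t), w) \<in> C} (\<lambda>t. nth_ev r (q(j := t)) w n)) \<and>
     (\<forall>j\<in>{1..N}. antimono_on {t. (r, q, w(j := t)) \<in> C} (\<lambda>t. max (nth_ev r q (w(j := t)) n) 0)) \<and>
     (\<forall>j\<in>{1..N}. mono_on {t. (r, q, w(j := t)) \<in> C} (\<lambda>t. min (nth_ev r q (w(j := t)) n) 0))"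
    if n: "n < N" and C: "C \<in> components (equation_space N)" and "(r, q, w) \<in> C" for n C r q w
  proof (intro conjI ballI monotone_onI)
    note sub = subsetD[OF in_components_subset[OF C]]
    show "nth_ev (r(j := t)) q w n \<le> nth_ev (r(j := s)) q w n"
      if "j \<in> {0..N-1}" "s \<in> {t. (r(j := t), q, w) \<in> C}" "t \<in> {t. (r(j := t), q, w) \<in> C}" "s \<le> t" for j s t
    proof (rule nth_ev_mono_energy[OF _ _ n])
      have j: "j < N" using that N_ge_2 by auto
      then have "(r(j := s)) j * (r(j := t)) j > 0"
        using that by (intro components_equation_space_sign[OF C, of "r(j := s)" q w "r(j := t)" q w]) auto
      then show "energy (r(j := t)) q y \<le> energy (r(j := s)) q y" for y
        using that j by (intro energy_antimono_reciprocal) auto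
    qed (use that sub in auto)
    \<comment> \<open>Nothing orders \<open>s\<close> and \<open>t\<close> here, so exchanging them
      gives equality.\<close>
    have "nth_ev (r(N := t)) q w n \<le> nth_ev (r(N := s)) q w n"
      if "(r(N := s), q, w) \<in> C" "(r(N := t), q, w) \<in> C" for s t
      using sub[OF that(1)] sub[OF that(2)] n
      by (rule nth_ev_mono_energy) (simp add: energy_last_reciprocal)
    then show "(\<lambda>t. nth_ev (r(N := t)) q w n) constant_on {t. (r(N := t), q, w) \<in> C}"
      unfolding constant_on_def by (metis (mono_tags) mem_Collect_eq order_antisym)
    show "nth_ev r (q(j := s)) w n \<le> nth_ev r (q(j := t)) w n"
      if "s \<in> {t. (r, q(j := t), w) \<in> C}" "t \<in> {t. (r, q(j := t), w) \<in> C}" "s \<le> t" for j s t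
      using that sub n by (intro nth_ev_mono_energy energy_mono_potential) auto
    show "max (nth_ev r q (w(j := t)) n) 0 \<le> max (nth_ev r q (w(j := s)) n) 0"
      "min (nth_ev r q (w(j := s)) n) 0 \<le> min (nth_ev r q (w(j := t)) n) 0"
      if "s \<in> {t. (r, q, w(j := t)) \<in> C}" "t \<in> {t. (r, q, w(j := t)) \<in> C}" "s \<le> t" for j s t
      using that sub n by (intro nth_ev_weight; auto)+
  qed
  ultimately show ?thesis unfolding ev by blast
qed

end
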